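(* Let $d\ge1$ and $n\ge1$ be integers and let $p\in[1,2]$. Let $u_0$ be (the density of) a probability measure on $\mathbb{R}^d$ such that $w_0:=u_0/v_\infty$ is bounded and $$\int_{\mathbb{R}^d}u_0\,H_k\,dx=0\quad\text{for every }k\in\mathbb{N}^d\text{ such that }0<|k|<n.$$ Let $u$ be the solution of the heat equation $\frac{\partial u}{\partial t}=\Delta u$, $t>0$, $x\in\mathbb{R}^d$, with initial condition $u_0$. Then, for all $t\ge0$, $$\|u(t,\cdot)-u_\infty(t,\cdot)\|_{L^p(\mathbb{R}^d)}\le(2\pi)^{-\frac d2\left(1-\frac1p\right)}\,\mathcal{A}_p\big(\mathcal{E}_p[w_0]\big)\,(1+2t)^{-\frac{n\,p}{4\,\mathcal{H}_p[w_0]}-\frac d2\left(1-\frac1p\right)}.$$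
   Context: $\mathbb{N}=\{0,1,2,\dots\}$. $v_\infty(x):=(2\pi)^{-d/2}e^{-|x|^2/2}$ and $d\mu:=v_\infty\,dx$ is the Gaussian probability measure on $\mathbb{R}^d$. With $G(t,x,y):=(4\pi t)^{-d/2}e^{-|x-y|^2/(4t)}$, the solution of the heat equation with initial condition $u_0$ is $u(t,x)=\int_{\mathbb{R}^d}u_0(y)\,G(t,x,y)\,dy$, and $u_\infty(t,x):=G(t+\tfrac12,x,0)=R^{-d}v_\infty(x/R)$ with $R=\sqrt{1+2t}$. For $k=(k_1,\dots,k_d)\in\mathbb{N}^d$, $|k|:=\sum_{j=1}^dk_j$ and $H_k(x):=\prod_{j=1}^dh_{k_j}(x_j)$, where for $m\in\mathbb{N}$ and $y\in\mathbb{R}$, $h_m(y):=(-1)^m(m!)^{-1/2}e^{y^2/2}\frac{d^m}{dy^m}\big(e^{-y^2/2}\big)$ (normalized Hermite polynomials). Generalized entropies: $\mathcal{E}_p[w]:=\int_{\mathbb{R}^d}\frac{w^p-1}{p-1}\,d\mu$ for $p\in(1,2]$, and $\mathcal{E}_1[w]:=\int_{\mathbb{R}^d}w\log w\,d\mu$ (with $0\log0=0$). For $s\ge0$ and $p\in[1,2]$, $$\mathcal{A}_p(s):=\frac{2^{1/p}}{\sqrt p}\,\big[1+(p-1)s\big]^{1-p/2}\sqrt s.$$ Define auxiliary functions $\mathsf{h}_p:[0,\infty)\to\mathbb{R}$ (denoted $h_p$ in the paper, not to be confused with the Hermite polynomials) by $\mathsf{h}_p(0)=1$, $\mathsf{h}_p(1)=p/2$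 and, for $s\in(0,1)\cup(1,\infty)$, $\mathsf{h}_p(s):=\frac{s^p-1-p(s-1)}{(p-1)|s-1|^2}$ if $p\in(1,2]$, $\mathsf{h}_1(s):=\frac{s\log s-(s-1)}{|s-1|^2}$. They are continuous, nonnegative and nonincreasing. For nonnegative $w\in L^\infty(\mathbb{R}^d)$, $$\mathcal{H}_p[w]:=\|w\|_{L^\infty(\mathbb{R}^d)}^{2-p}\,\sup_{x\in\mathbb{R}^d}\mathsf{h}_p(w(x))=\|w\|_{L^\infty(\mathbb{R}^d)}^{2-p}\,\mathsf{h}_p\Big(\inf_{x\in\mathbb{R}^d}w(x)\Big),$$ where sup and inf are essential. *)

theory Defs
  imports "HOL-Probability.Essential_Supremum"
begin

definition v_infty :: "real ^ 'd \<Rightarrow> real" where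
  "v_infty x = (2 * pi) powr (- real CARD('d) / 2) * exp (- (norm x)\<^sup>2 / 2)"

definition gauss_measure :: "(real ^ 'd) measure" where
  "gauss_measure = density lborel (\<lambda>x. ennreal (v_infty x))"

definition heat_kernel :: "real \<Rightarrow> real ^ 'd \<Rightarrow> real ^ 'd \<Rightarrow> real" where
  "heat_kernel t x y =
     (4 * pi * t) powr (- real CARD('d) / 2) * exp (- (norm (x - y))\<^sup>2 / (4 * t))"

text \<open>At \<open>t = 0\<close> the kernel is singular, and the solution is the initial condition itself.\<close>

definition heat_solution :: "(real ^ 'd \<Rightarrow> real) \<Rightarrow> real \<Rightarrow> real ^ 'd \<Rightarrow> real" where
  "heat_solution u0 t x =
     (if t = 0 then u0 x else (\<integral>y. u0 y * heat_kernel t x y \<partial>lborel))"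

definition u_infty :: "real \<Rightarrow> real ^ 'd \<Rightarrow> real" where
  "u_infty t x = heat_kernel (t + 1 / 2) x 0"

definition hermite :: "nat \<Rightarrow> real \<Rightarrow> real" where
  "hermite m y =
     (- 1) ^ m * (fact m) powr (- 1 / 2) * exp (y\<^sup>2 / 2) * (deriv ^^ m) (\<lambda>z. exp (- z\<^sup>2 / 2)) y"

text \<open>Multi-indices are functions on the index type of the coordinates.\<close>

definition multi_hermite :: "('d \<Rightarrow> nat) \<Rightarrow> real ^ 'd \<Rightarrow> real" where
  "multi_hermite k x = (\<Prod>j\<in>UNIV. hermite (k j) (x $ j))"

text \<open>The case \<open>p = 1\<close> relies on the library convention \<open>ln 0 = 0\<close>
  (only the product \<open>0 * ln 0 = 0\<close> matters).\<close>

definition entropy_p :: "real \<Rightarrow> (real ^ 'd \<Rightarrow> real) \<Rightarrow> real" where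
  "entropy_p p w =
     (if p = 1 then (\<integral>x. w x * ln (w x) \<partial>gauss_measure)
      else (\<integral>x. (w x powr p - 1) / (p - 1) \<partial>gauss_measure))"

definition A_fun :: "real \<Rightarrow> real \<Rightarrow> real" where
  "A_fun p s = 2 powr (1 / p) / sqrt p * (1 + (p - 1) * s) powr (1 - p / 2) * sqrt s"

definition h_fun :: "real \<Rightarrow> real \<Rightarrow> real" where
  "h_fun p s =
     (if s = 0 then 1
      else if s = 1 then p / 2
      else if p = 1 then (s * ln s - (s - 1)) / \<bar>s - 1\<bar>\<^sup>2
      else (s powr p - 1 - p * (s - 1)) / ((p - 1) * \<bar>s - 1\<bar>\<^sup>2))"

text \<open>The library's \<open>esssup\<close> takes values in a complete order, hence the passage through \<open>ereal\<close>;
  both suprema are finite for nonnegative essentially bounded measurable \<open>w\<close>.\<close>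

definition Linfty_norm :: "(real ^ 'd \<Rightarrow> real) \<Rightarrow> real" where
  "Linfty_norm w = real_of_ereal (esssup lborel (\<lambda>x. ereal \<bar>w x\<bar>))"

definition H_functional :: "real \<Rightarrow> (real ^ 'd \<Rightarrow> real) \<Rightarrow> real" where
  "H_functional p w =
     Linfty_norm w powr (2 - p) * real_of_ereal (esssup lborel (\<lambda>x. ereal (h_fun p (w x))))"

text \<open>The \<open>L\<^sup>p\<close> norm is extended-valued (\<open>\<infinity>\<close> for functions outside \<open>L\<^sup>p\<close>), so that a finite upper
  bound on it includes membership in \<open>L\<^sup>p\<close>.\<close>

definition Lp_norm :: "real \<Rightarrow> (real ^ 'd \<Rightarrow> real) \<Rightarrow> ennreal" where
  "Lp_norm p f =
     (let I = (\<integral>\<^sup>+x. ennreal (\<bar>f x\<bar> powr p) \<partial>lborel)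
      in if I = \<infinity> then \<infinity> else ennreal (enn2real I powr (1 / p)))"

end

theory Submission
  imports Defs "HOL-Probability.Distributions" "HOL-Real_Asymp.Real_Asymp"
begin

text \<open>In self-similar variables \<open>w = u / u\<^sub>\<infinity>\<close> evolves by the Ornstein--Uhlenbeck semigroup, that is, by the
  Markov operators \<open>T\<^sub>\<rho>\<close> whose kernel \<open>K\<^sub>\<rho>\<close> with respect to the Gaussian measure is given by Mehler's formula.
  Every differentiation in time is replaced by a discrete argument.

  One step: \<open>\<phi>\<^sub>p(s) = (s\<^sup>p - 1 - p (s - 1)) / (p - 1)\<close> satisfies \<open>\<phi>\<^sub>p'' \<ge> p M\<^sup>p\<^sup>-\<^sup>2\<close> on \<open>[0, M]\<close>, so Jensen's
  inequality for \<open>\<phi>\<^sub>p - (p M\<^sup>p\<^sup>-\<^sup>2 / 2) s\<^sup>2\<close> shows that \<open>T\<^sub>\<rho>\<close> lowers the entropy by at least \<open>p M\<^sup>p\<^sup>-\<^sup>2 / 2\<close>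
  times the decrease of the squared \<open>L\<^sup>2\<close> norm of \<open>w - 1\<close>. With \<open>E \<le> S \<parallel>w - 1\<parallel>\<^sup>2\<close>, where \<open>S\<close> bounds
  \<open>h\<^sub>p(w)\<close>, and the contraction \<open>\<parallel>T\<^sub>\<rho> (w - 1)\<parallel>\<^sup>2 \<le> \<rho>\<^sup>2\<^sup>n \<parallel>w - 1\<parallel>\<^sup>2\<close> this bounds the entropy after one
  step; subdividing \<open>T\<^sub>\<sigma>\<close> into \<open>N\<close> equal steps and letting \<open>N \<rightarrow> \<infinity>\<close> gives the sharp rate.

  Contraction without an eigenfunction expansion: \<open>a\<^sub>m = \<parallel>T\<^sub>\<rho>\<^sup>m g\<parallel>\<^sup>2\<close> is log-convex in \<open>m\<close>, so it is enough
  to have \<open>a\<^sub>m = O(\<rho>\<^sup>2\<^sup>n\<^sup>m)\<close> with an arbitrary constant. This follows from the Taylor expansion of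
  \<open>K\<^sub>\<rho>(x, y)\<close> in \<open>\<rho>\<close>, whose coefficients of order less than \<open>n\<close> are polynomials in \<open>y\<close> of degree less
  than \<open>n\<close>. A Csiszar--Kullback inequality converts the entropy into the \<open>L\<^sup>p\<close> distance.\<close>

section \<open>The entropy density\<close>

text \<open>Each branch is the integrand of \<open>entropy_p\<close> minus a multiple of
  \<open>s - 1\<close>. That multiple integrates to zero against a density of mean one and makes
  both the value and the slope at 1 vanish.\<close>

definition phi :: "real \<Rightarrow> real \<Rightarrow> real" where
  "phi p s = (if p = 1 then s * ln s - (s - 1) else (s powr p - 1 - p * (s - 1)) / (p - 1))"

definition dphi :: "real \<Rightarrow> real \<Rightarrow> real" where
  "dphi p s = (if p = 1 then ln s else p * (s powr (p - 1) - 1) / (p - 1))"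

text \<open>Asking for a derivative only in the open interval lets the endpoint 0 be reached, where
  \<open>DERIV_phi\<close> says nothing.\<close>

lemma MVT_real:
  fixes f :: "real \<Rightarrow> real"
  assumes "a < b" "continuous_on {a..b} f"
    and "\<And>x. a < x \<Longrightarrow> x < b \<Longrightarrow> (f has_real_derivative f' x) (at x)"
  obtains z where "a < z" "z < b" "f b - f a = (b - a) * f' z"
proof -
  obtain z where "a < z" "z < b" "f b - f a = (\<lambda>h. f' z * h) (b - a)"
    using mvt[OF assms(1,2), of "\<lambda>x h. f' x * h"] assms(3) unfolding has_field_derivative_def by blast
  then show ?thesis using that by (simp add: mult.commute)
qed

lemma phi_0 [simp]: "1 \<le> p \<Longrightarrow> phi p 0 = 1"
  by (auto simp: phi_def)

lemma phi_1 [simp]: "phi p 1 = 0"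
  by (auto simp: phi_def)

lemma dphi_1 [simp]: "dphi p 1 = 0"
  by (auto simp: dphi_def)

lemma DERIV_phi: "0 < s \<Longrightarrow> 1 \<le> p \<Longrightarrow> (phi p has_real_derivative dphi p s) (at s)"
proof (cases "p = 1")
  case True
  assume "0 < s"
  then show ?thesis unfolding phi_def dphi_def True
    by (auto intro!: derivative_eq_intros)
next
  case False
  assume "0 < s" "1 \<le> p"
  then have "((\<lambda>s. (s powr p - 1 - p * (s - 1)) / (p - 1)) has_real_derivative
      (p * s powr (p - 1) - p) / (p - 1)) (at s)"
    by (intro DERIV_cdivide) (auto intro!: derivative_eq_intros)
  with False show ?thesis by (simp add: phi_def[abs_def] dphi_def right_diff_distrib)
qed

lemma DERIV_dphi: "0 < s \<Longrightarrow> 1 \<le> p \<Longrightarrow> (dphi p has_real_derivative p * s powr (p - 2)) (at s)"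
proof (cases "p = 1")
  case True
  assume "0 < s"
  then show ?thesis unfolding dphi_def True
    by (auto intro!: derivative_eq_intros simp: powr_minus inverse_eq_divide)
next
  case False
  assume "0 < s" "1 \<le> p"
  then have "((\<lambda>s. p * (s powr (p - 1) - 1) / (p - 1)) has_real_derivative
      p * ((p - 1) * s powr (p - 2)) / (p - 1)) (at s)"
    by (intro DERIV_cdivide DERIV_cmult) (auto intro!: derivative_eq_intros)
  with False show ?thesis by (simp add: dphi_def[abs_def])
qed

lemma continuous_on_phi: "1 \<le> p \<Longrightarrow> continuous_on {0..} (phi p)"
proof (cases "p = 1")
  case True
  have *: "((\<lambda>s::real. s * ln s) \<longlongrightarrow> 0) (at 0 within {0..})"
    unfolding at_within_Ici_at_right by real_asymp
  have "continuous_on {0..} (\<lambda>s::real. s * ln s)"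
    unfolding continuous_on_def
  proof
    fix s :: real assume s: "s \<in> {0..}"
    show "((\<lambda>s. s * ln s) \<longlongrightarrow> s * ln s) (at s within {0..})"
    proof (cases "s = 0")
      case True then show ?thesis using * by simp
    next
      case False with s show ?thesis by (auto intro!: tendsto_intros)
    qed
  qed
  then show ?thesis unfolding phi_def True by (auto intro!: continuous_intros)
next
  case False
  assume "1 \<le> p"
  with False have "continuous_on {0..} (\<lambda>s::real. s powr p)"
    by (intro continuous_on_powr') (auto intro!: continuous_intros)
  with False show ?thesis unfolding phi_def by (auto intro!: continuous_intros)
qed

lemma phi_measurable [measurable]: "phi p \<in> borel_measurable borel"
  unfolding phi_def by (cases "p = 1") simp_all

text \<open>Since p is at most 2, the second derivative \<open>p * s powr (p - 2)\<close> is
  smallest at \<open>s = M\<close>. Hence \<open>F\<close>, which is \<open>phi p\<close> minus its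
  tangent at \<open>b\<close> and minus the quadratic, has a nondecreasing derivative vanishing at
  \<open>b\<close>, and is nonnegative. The point \<open>a\<close> may be 0, but the tangent point
  \<open>b\<close> may not.\<close>

lemma phi_strong_convexity:
  assumes p: "1 \<le> p" "p \<le> 2" and a: "0 \<le> a" "a \<le> M" and b: "0 < b" "b \<le> M"
  shows "p * M powr (p - 2) / 2 * (a - b)\<^sup>2 \<le> phi p a - phi p b - dphi p b * (a - b)"
proof -
  define c where "c = p * M powr (p - 2)"
  define F where "F s = phi p s - phi p b - dphi p b * (s - b) - c / 2 * (s - b)\<^sup>2" for s
  define F' where "F' s = dphi p s - dphi p b - c * (s - b)" for s
  have M: "0 < M" using b by simp
  have DF: "(F has_real_derivative F' s) (at s)" if "0 < s" for s
    unfolding F_def F'_def using that p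
    by (auto intro!: derivative_eq_intros DERIV_phi simp: field_simps)
  have DF': "(F' has_real_derivative p * s powr (p - 2) - c) (at s)" if "0 < s" for s
    unfolding F'_def using that p
    by (auto intro!: derivative_eq_intros DERIV_dphi)
  have nn: "0 \<le> p * s powr (p - 2) - c" if "0 < s" "s \<le> M" for s
    unfolding c_def using p that
    by (simp, intro mult_left_mono powr_mono2') auto
  have mono: "F' s \<le> F' r" if "0 < s" "s \<le> r" "r \<le> M" for s r
  proof (rule DERIV_nonneg_imp_nondecreasing[OF that(2)])
    fix x assume "s \<le> x" "x \<le> r"
    with that DF'[of x] nn[of x] show "\<exists>y. (F' has_real_derivative y) (at x) \<and> 0 \<le> y"
      by (intro exI[of _ "p * x powr (p - 2) - c"]) auto
  qed
  have F'b: "F' b = 0" by (simp add: F'_def)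
  have contF: "continuous_on {0..} F"
    unfolding F_def by (intro continuous_intros continuous_on_phi p)
  have Fb: "F b = 0" by (simp add: F_def)
  have "0 \<le> F a"
  proof (cases "a = b")
    case True then show ?thesis using Fb by simp
  next
    case ab: False
    show ?thesis
    proof (cases "a < b")
      case True
      have cont: "continuous_on {a..b} F" using a by (intro continuous_on_subset[OF contF]) auto
      obtain z where z: "a < z" "z < b" "F b - F a = (b - a) * F' z"
        by (rule MVT_real[OF True cont, of F']) (use DF a in \<open>auto\<close>)
      have "F' z \<le> 0" using mono[of z b] z a b F'b by auto
      then have "(b - a) * F' z \<le> 0" using True by (simp add: mult_nonneg_nonpos)
      then show ?thesis using z Fb by simp
    next
      case False
      then have ba: "b < a" using ab by simp
      have cont: "continuous_on {b..a} F" using b by (intro continuous_on_subset[OF contF]) auto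
      obtain z where z: "b < z" "z < a" "F a - F b = (a - b) * F' z"
        by (rule MVT_real[OF ba cont, of F']) (use DF b in \<open>auto\<close>)
      have "0 \<le> F' z" using mono[of b z] z a b F'b by auto
      then have "0 \<le> (a - b) * F' z" using ba by simp
      then show ?thesis using z Fb by simp
    qed
  qed
  then show ?thesis by (simp add: F_def c_def)
qed

lemma phi_lower:
  assumes "1 \<le> p" "p \<le> 2" "0 \<le> s" "s \<le> M" "1 \<le> M"
  shows "p * M powr (p - 2) / 2 * (s - 1)\<^sup>2 \<le> phi p s"
  using phi_strong_convexity[of p s M 1] assms by simp

lemma phi_nonneg: "1 \<le> p \<Longrightarrow> p \<le> 2 \<Longrightarrow> 0 \<le> s \<Longrightarrow> 0 \<le> phi p s"
  using phi_lower[of p s "max 1 s"]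
  by (smt (verit) mult_nonneg_nonneg powr_ge_zero zero_le_power2 divide_nonneg_nonneg)

text \<open>Above 1 the second derivative is at most p; integrating twice from 1 gives the quadratic
  bound.\<close>

lemma phi_upper:
  assumes p: "1 \<le> p" "p \<le> 2" and s: "1 \<le> s"
  shows "phi p s \<le> p / 2 * (s - 1)\<^sup>2"
proof -
  have *: "dphi p r - p * (r - 1) \<le> 0" if "1 \<le> r" for r
  proof -
    have "dphi p r - p * (r - 1) \<le> dphi p 1 - p * (1 - 1)"
    proof (rule DERIV_nonpos_imp_nonincreasing[OF that])
      fix x assume "1 \<le> x" "x \<le> r"
      then have "((\<lambda>r. dphi p r - p * (r - 1)) has_real_derivative p * x powr (p - 2) - p) (at x)"
        using p by (auto intro!: derivative_eq_intros DERIV_dphi)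
      moreover have "x powr (p - 2) \<le> 1"
        using p \<open>1 \<le> x\<close> powr_mono[of "p - 2" 0 x] by simp
      then have "p * x powr (p - 2) - p \<le> 0" using p by (simp add: mult_le_cancel_left1)
      ultimately show "\<exists>y. ((\<lambda>r. dphi p r - p * (r - 1)) has_real_derivative y) (at x) \<and> y \<le> 0" by blast
    qed
    then show ?thesis by simp
  qed
  have "phi p s - p / 2 * (s - 1)\<^sup>2 \<le> phi p 1 - p / 2 * (1 - 1)\<^sup>2"
  proof (rule DERIV_nonpos_imp_nonincreasing[OF s])
    fix x assume x: "1 \<le> x" "x \<le> s"
    then have "((\<lambda>s. phi p s - p / 2 * (s - 1)\<^sup>2) has_real_derivative dphi p x - p * (x - 1)) (at x)"
      using p by (auto intro!: derivative_eq_intros DERIV_phi)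
    with *[of x] x show "\<exists>y. ((\<lambda>s. phi p s - p / 2 * (s - 1)\<^sup>2) has_real_derivative y) (at x) \<and> y \<le> 0"
      by blast
  qed
  then show ?thesis by simp
qed

text \<open>\<open>dphi p\<close> is concave, so its tangent at \<open>r\<close>, evaluated at 1,
  lies above \<open>dphi p 1 = 0\<close>. Concretely this is \<open>ln x \<le> x - 1\<close> for p =
  1 and a weighted arithmetic-geometric mean inequality otherwise.\<close>

lemma dphi_concave_tangent:
  assumes p: "1 \<le> p" "p \<le> 2" and r: "0 < r"
  shows "0 \<le> dphi p r + p * r powr (p - 2) * (1 - r)"
proof (cases "p = 1")
  case True
  have "ln (1 / r) \<le> 1 / r - 1" using r by (intro ln_le_minus_one) auto
  then show ?thesis using True r by (simp add: dphi_def ln_div powr_minus inverse_eq_divide field_simps)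
next
  case False
  have *: "r powr (2 - p) \<le> (p - 1) + (2 - p) * r"
  proof (cases "p = 2")
    case False
    with \<open>p \<noteq> 1\<close> p have "(1::real) powr (p - 1) * r powr (2 - p) \<le> (p - 1) * 1 + (2 - p) * r"
      using Youngs_inequality_0[of "p - 1" "2 - p" 1 r] r by simp
    then show ?thesis by simp
  qed (use r in simp)
  have "1 = r powr (p - 2) * r powr (2 - p)" using r by (simp add: powr_add[symmetric])
  also have "\<dots> \<le> r powr (p - 2) * ((p - 1) + (2 - p) * r)"
    by (intro mult_left_mono *) auto
  finally have 1: "1 \<le> r powr (p - 2) * ((p - 1) + (2 - p) * r)" .
  have 2: "r powr (p - 1) = r * r powr (p - 2)" using r by (simp add: powr_mult_base)
  have "dphi p r + p * r powr (p - 2) * (1 - r) =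
      p / (p - 1) * (r powr (p - 2) * ((p - 1) + (2 - p) * r) - 1)"
    using False p by (simp add: dphi_def 2 field_simps)
  also have "\<dots> \<ge> 0" using 1 p by (intro mult_nonneg_nonneg) auto
  finally show ?thesis by simp
qed

text \<open>This is the monotonicity of the quotient \<open>D\<close> below 1. Its derivative is
  \<open>q x / (1 - x) ^ 3\<close>, where \<open>q\<close> vanishes at 1 and is nondecreasing by
  \<open>dphi_concave_tangent\<close>, hence is nonpositive.\<close>

lemma phi_ratio_mono:
  assumes p: "1 \<le> p" "p \<le> 2" and s: "0 \<le> s" "s \<le> r" "r \<le> 1"
    and le: "phi p s \<le> S * (s - 1)\<^sup>2"
  shows "phi p r \<le> S * (r - 1)\<^sup>2"
proof (cases "s = r \<or> r = 1")
  case True then show ?thesis using le by auto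
next
  case False
  then have s': "s < r" "r < 1" using s by auto
  define D where "D x = phi p x / (1 - x)\<^sup>2" for x
  define q where "q x = dphi p x * (1 - x) + 2 * phi p x" for x
  have q: "q x \<le> 0" if x: "0 < x" "x \<le> 1" for x
  proof -
    have "q x \<le> q 1"
    proof (rule DERIV_nonneg_imp_nondecreasing[OF x(2)])
      fix y assume y: "x \<le> y" "y \<le> 1"
      with x have "(q has_real_derivative p * y powr (p - 2) * (1 - y) + dphi p y) (at y)"
        unfolding q_def using p
        by (auto intro!: derivative_eq_intros DERIV_phi DERIV_dphi)
      with dphi_concave_tangent[OF p, of y] x y
      show "\<exists>z. (q has_real_derivative z) (at y) \<and> 0 \<le> z" by (auto simp: add.commute)
    qed
    then show ?thesis by (simp add: q_def)
  qed
  have DD: "(D has_real_derivative q x / (1 - x) ^ 3) (at x)" if "0 < x" "x < 1" for x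
  proof -
    have "(D has_real_derivative (dphi p x * (1 - x)\<^sup>2 - phi p x * (2 * (1 - x) * (- 1))) / ((1 - x)\<^sup>2)\<^sup>2) (at x)"
      unfolding D_def using that p
      by (auto intro!: derivative_eq_intros DERIV_phi simp: power2_eq_square)
    also have "(dphi p x * (1 - x)\<^sup>2 - phi p x * (2 * (1 - x) * (- 1))) / ((1 - x)\<^sup>2)\<^sup>2 = ((1 - x) * q x) / ((1 - x) * (1 - x) ^ 3)"
      unfolding q_def by (rule arg_cong2[of _ _ _ _ "(/)"]) (simp_all add: power2_eq_square power3_eq_cube algebra_simps)
    also have "\<dots> = q x / (1 - x) ^ 3" using that by simp
    finally show ?thesis .
  qed
  have cont: "continuous_on {s..r} D"
    unfolding D_def using s s'
    by (intro continuous_intros continuous_on_subset[OF continuous_on_phi[OF p(1)]]) auto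
  obtain z where z: "s < z" "z < r" "D r - D s = (r - s) * (q z / (1 - z) ^ 3)"
    by (rule MVT_real[OF s'(1) cont, of "\<lambda>z. q z / (1 - z) ^ 3"]) (use DD s s' in \<open>auto\<close>)
  have "q z / (1 - z) ^ 3 \<le> 0" using q[of z] z s s' by (intro divide_nonpos_nonneg) auto
  then have "(r - s) * (q z / (1 - z) ^ 3) \<le> 0" using s' by (intro mult_nonneg_nonpos) auto
  then have "D r \<le> D s" using z by simp
  also have "D s \<le> S" using le s s' by (simp add: D_def field_simps power2_commute)
  finally show ?thesis using s' by (simp add: D_def field_simps power2_commute)
qed

lemma h_fun_eq: "s \<noteq> 1 \<Longrightarrow> 1 \<le> p \<Longrightarrow> h_fun p s = phi p s / (s - 1)\<^sup>2"
  by (auto simp: h_fun_def phi_def)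

lemma h_fun_measurable [measurable]: "h_fun p \<in> borel_measurable borel"
  unfolding h_fun_def by measurable

lemma phi_le_h_fun: "1 \<le> p \<Longrightarrow> h_fun p s \<le> S \<Longrightarrow> phi p s \<le> S * (s - 1)\<^sup>2"
  by (cases "s = 1") (auto simp: h_fun_eq divide_le_eq)

lemma h_fun_ge_half: "1 \<le> p \<Longrightarrow> p \<le> 2 \<Longrightarrow> 0 \<le> s \<Longrightarrow> s \<le> 1 \<Longrightarrow> p / 2 \<le> h_fun p s"
  using phi_lower[of p s 1] by (cases "s = 1") (auto simp: h_fun_eq h_fun_def[of _ 1] le_divide_eq)

text \<open>Below 1 the quotient is at most its value 1 at \<open>s = 0\<close>; above 1 it is at
  most \<open>p / 2\<close>. The bound makes the essential supremum of \<open>h_fun p\<close>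
  finite.\<close>

lemma h_fun_le_1:
  assumes p: "1 \<le> p" "p \<le> 2" and s: "0 \<le> s"
  shows "h_fun p s \<le> 1"
proof -
  consider "s < 1" | "s = 1" | "1 < s" by linarith
  then show ?thesis
  proof cases
    case 1 then show ?thesis using phi_ratio_mono[OF p, of 0 s 1] p s by (simp add: h_fun_eq divide_le_eq)
  next
    case 2 then show ?thesis using p by (simp add: h_fun_def)
  next
    case 3
    have "phi p s \<le> p / 2 * (s - 1)\<^sup>2" using 3 phi_upper[OF p] by simp
    also have "\<dots> \<le> 1 * (s - 1)\<^sup>2" using p by (intro mult_right_mono) auto
    finally show ?thesis using 3 p by (simp add: h_fun_eq divide_le_eq)
  qed
qed

lemma h_fun_nonneg: "1 \<le> p \<Longrightarrow> p \<le> 2 \<Longrightarrow> 0 \<le> s \<Longrightarrow> 0 \<le> h_fun p s"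
  using phi_nonneg[of p s] by (cases "s = 1") (auto simp: h_fun_eq h_fun_def[of _ 1])

text \<open>A quadratic bound known at the lower bound of a density holds at all its values. The
  constant \<open>S\<close> therefore stays valid along the flow, which preserves lower
  bounds.\<close>

lemma phi_le_up:
  assumes p: "1 \<le> p" "p \<le> 2" and s: "0 \<le> s" "s \<le> r" and S: "p / 2 \<le> S"
    and le: "phi p s \<le> S * (s - 1)\<^sup>2"
  shows "phi p r \<le> S * (r - 1)\<^sup>2"
proof (cases "r \<le> 1")
  case True then show ?thesis using phi_ratio_mono p s le by blast
next
  case False
  then have "phi p r \<le> p / 2 * (r - 1)\<^sup>2" using phi_upper[OF p] by simp
  also have "\<dots> \<le> S * (r - 1)\<^sup>2" using S by (intro mult_right_mono) auto
  finally show ?thesis .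
qed

section \<open>Symmetric Markov kernels\<close>

text \<open>Log-convexity makes the ratios of consecutive terms nondecreasing. If the first ratio
  \<open>r\<close> exceeded \<open>q\<close>, then \<open>a m\<close> would be at least
  \<open>a 0 * r ^ m\<close>, which outgrows \<open>C * q ^ m\<close> for every constant
  \<open>C\<close>.\<close>

lemma log_convex_decay:
  fixes a :: "nat \<Rightarrow> real"
  assumes nn: "\<And>m. 0 \<le> a m" and lc: "\<And>m. (a (Suc m))\<^sup>2 \<le> a m * a (Suc (Suc m))"
    and q: "0 < q" and decay: "\<And>m. m0 \<le> m \<Longrightarrow> a m \<le> C * q ^ m"
  shows "a 1 \<le> q * a 0"
proof (rule ccontr)
  assume "\<not> a 1 \<le> q * a 0"
  then have gt: "q * a 0 < a 1" by simp
  have a1: "0 < a 1" using gt nn[of 0] q by (smt (verit) mult_nonneg_nonneg)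
  have a0: "0 < a 0"
  proof (rule ccontr)
    assume "\<not> 0 < a 0"
    then have "a 0 = 0" using nn[of 0] by simp
    then show False using lc[of 0] a1 by simp
  qed
  define r where "r = a 1 / a 0"
  have r: "q < r" using gt a0 by (simp add: r_def field_simps)
  have *: "0 < a m \<and> r * a m \<le> a (Suc m)" for m
  proof (induction m)
    case 0 then show ?case using a0 by (simp add: r_def)
  next
    case (Suc m)
    have pos: "0 < a (Suc m)" using Suc r q by (smt (verit) mult_pos_pos)
    have "a m * (r * a (Suc m)) \<le> (a (Suc m))\<^sup>2"
      using mult_right_mono[of "r * a m" "a (Suc m)" "a (Suc m)"] Suc pos
      by (simp add: power2_eq_square algebra_simps)
    also have "\<dots> \<le> a m * a (Suc (Suc m))" by (rule lc)
    finally show ?case using pos Suc by simp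
  qed
  have lower: "a 0 * r ^ m \<le> a m" for m
  proof (induction m)
    case (Suc m)
    have "a 0 * r ^ Suc m = r * (a 0 * r ^ m)" by simp
    also have "\<dots> \<le> r * a m" using Suc r q by (intro mult_left_mono) auto
    also have "\<dots> \<le> a (Suc m)" using * by blast
    finally show ?case .
  qed simp
  have "1 < r / q" using r q by simp
  then obtain N where N: "C / a 0 < (r / q) ^ N" using real_arch_pow by blast
  define m where "m = max N m0"
  have "C / a 0 < (r / q) ^ m"
    using N power_increasing[of N m "r / q"] \<open>1 < r / q\<close> unfolding m_def by linarith
  then have "C * q ^ m < a 0 * r ^ m"
    using a0 q by (simp add: power_divide field_simps)
  also have "\<dots> \<le> a m" by (rule lower)
  also have "\<dots> \<le> C * q ^ m" by (rule decay) (simp add: m_def)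
  finally show False by simp
qed

text \<open>The bound holds everywhere and not just almost everywhere, so that pointwise estimates
  pass through kernels without null sets. The essentially bounded density is truncated to fit at the
  very end.\<close>

definition bounded_meas :: "'a measure \<Rightarrow> ('a \<Rightarrow> real) \<Rightarrow> bool" where
  "bounded_meas M f \<longleftrightarrow> f \<in> borel_measurable M \<and> (\<exists>B. \<forall>x. \<bar>f x\<bar> \<le> B)"

lemma bounded_measI: "f \<in> borel_measurable M \<Longrightarrow> (\<And>x. \<bar>f x\<bar> \<le> B) \<Longrightarrow> bounded_meas M f"
  by (auto simp: bounded_meas_def)

lemma bounded_meas_measurable [measurable_dest]: "bounded_meas M f \<Longrightarrow> f \<in> borel_measurable M"
  by (simp add: bounded_meas_def)

lemma bounded_measE:
  assumes "bounded_meas M f"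
  obtains B where "0 \<le> B" "\<And>x. \<bar>f x\<bar> \<le> B"
proof -
  obtain B where "\<And>x. \<bar>f x\<bar> \<le> B" using assms by (auto simp: bounded_meas_def)
  then have "0 \<le> \<bar>B\<bar>" "\<And>x. \<bar>f x\<bar> \<le> \<bar>B\<bar>" by (simp_all add: order_trans[OF _ abs_ge_self])
  then show ?thesis using that by blast
qed

lemma bounded_meas_const: "bounded_meas M (\<lambda>x. c)"
  by (rule bounded_measI[of _ _ "\<bar>c\<bar>"]) auto

lemma bounded_meas_add:
  assumes "bounded_meas M f" "bounded_meas M g"
  shows "bounded_meas M (\<lambda>x. f x + g x)"
proof -
  obtain A B where "\<And>x. \<bar>f x\<bar> \<le> A" "\<And>x. \<bar>g x\<bar> \<le> B" using assms by (metis bounded_measE)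
  then have "\<bar>f x + g x\<bar> \<le> A + B" for x by (meson abs_triangle_ineq add_mono order_trans)
  then show ?thesis using assms by (intro bounded_measI) (auto dest: bounded_meas_measurable)
qed

lemma bounded_meas_mult:
  assumes "bounded_meas M f" "bounded_meas M g"
  shows "bounded_meas M (\<lambda>x. f x * g x)"
proof -
  obtain A B where "0 \<le> A" "\<And>x. \<bar>f x\<bar> \<le> A" "\<And>x. \<bar>g x\<bar> \<le> B" using assms by (metis bounded_measE)
  then have "\<bar>f x * g x\<bar> \<le> A * B" for x by (simp add: abs_mult mult_mono)
  then show ?thesis using assms by (intro bounded_measI) (auto dest: bounded_meas_measurable)
qed

lemma bounded_meas_diff:
  assumes "bounded_meas M f" "bounded_meas M g"
  shows "bounded_meas M (\<lambda>x. f x - g x)"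
  using bounded_meas_add[OF assms(1) bounded_meas_mult[OF bounded_meas_const[of M "-1"] assms(2)]] by simp

lemma bounded_meas_power2: "bounded_meas M f \<Longrightarrow> bounded_meas M (\<lambda>x. (f x)\<^sup>2)"
  unfolding power2_eq_square by (rule bounded_meas_mult)

lemmas bounded_meas_intros =
  bounded_meas_const bounded_meas_add bounded_meas_mult bounded_meas_diff bounded_meas_power2

lemma phi_bounded:
  assumes "1 \<le> p" "p \<le> 2" "0 \<le> s" "s \<le> B"
  shows "\<bar>phi p s\<bar> \<le> (B + 1)\<^sup>2"
proof -
  have "phi p s \<le> (s - 1)\<^sup>2" using phi_le_h_fun[of p s 1] h_fun_le_1[of p s] assms by simp
  also have "\<bar>s - 1\<bar> \<le> \<bar>B + 1\<bar>" using assms by auto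
  then have "(s - 1)\<^sup>2 \<le> (B + 1)\<^sup>2" by (simp add: abs_le_square_iff)
  finally show ?thesis using phi_nonneg[of p s] assms by simp
qed

lemma bounded_meas_phi:
  assumes "1 \<le> p" "p \<le> 2" "bounded_meas M w" "\<And>x. 0 \<le> w x"
  shows "bounded_meas M (\<lambda>x. phi p (w x))"
proof -
  obtain B where "\<And>x. \<bar>w x\<bar> \<le> B" using assms(3) by (metis bounded_measE)
  then have "\<bar>phi p (w x)\<bar> \<le> (B + 1)\<^sup>2" for x
    using phi_bounded[OF assms(1,2), of "w x" B] assms(4)[of x] abs_le_D1 by blast
  then show ?thesis using assms(3) by (intro bounded_measI) (auto dest: bounded_meas_measurable)
qed

section \<open>A Csiszar--Kullback inequality on probability spaces\<close>

context prob_space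
begin

lemma bounded_meas_integrable: "bounded_meas M f \<Longrightarrow> integrable M f"
  unfolding bounded_meas_def by (metis AE_I2 integrable_const_bound real_norm_def)

text \<open>Hoelder's inequality with exponents \<open>2 / p\<close> and \<open>2 / (2 - p)\<close>,
  applied to a weighted square controlled by the entropy and to a weight controlled by the integral
  of \<open>w powr p\<close>.\<close>

lemma Lp_distance_le_A_fun:
  assumes p: "1 \<le> p" "p \<le> 2" and w: "bounded_meas M w" "\<And>x. 0 \<le> w x" and w1: "(\<integral>x. w x \<partial>M) = 1"
  shows "(\<integral>x. \<bar>w x - 1\<bar> powr p \<partial>M) powr (1 / p) \<le> A_fun p (\<integral>x. phi p (w x) \<partial>M)"
proof -
  define E where "E = (\<integral>x. phi p (w x) \<partial>M)"
  have [measurable]: "w \<in> borel_measurable M" using w(1) by (rule bounded_meas_measurable)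
  obtain B where B: "0 \<le> B" "\<And>x. \<bar>w x\<bar> \<le> B" using w(1) by (metis bounded_measE)
  have bphi: "bounded_meas M (\<lambda>x. phi p (w x))" by (rule bounded_meas_phi[OF p w])
  have E0: "0 \<le> E" unfolding E_def by (intro integral_nonneg_AE AE_I2 phi_nonneg p w)
  \<comment> \<open>The weight in \<alpha> is the convexity constant of \<open>phi_lower\<close>
    with \<open>M = max 1 (w x)\<close> chosen pointwise. It cancels against \<beta> in the product
    \<open>split\<close>.\<close>
  define \<alpha> where "\<alpha> x = (max 1 (w x)) powr (p - 2) * (w x - 1)\<^sup>2" for x
  define \<beta> where "\<beta> x = (max 1 (w x)) powr p" for x
  have \<alpha>_le: "\<alpha> x \<le> 2 / p * phi p (w x)" for x
    using phi_lower[OF p w(2), of x "max 1 (w x)"] p by (simp add: \<alpha>_def field_simps)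
  have \<alpha>0: "0 \<le> \<alpha> x" for x by (simp add: \<alpha>_def)
  have \<beta>1: "1 \<le> \<beta> x" for x unfolding \<beta>_def using p by (intro ge_one_powr_ge_zero) auto
  have \<beta>0: "0 \<le> \<beta> x" for x using \<beta>1[of x] by linarith
  have \<beta>_le: "\<beta> x \<le> 1 + w x powr p" for x by (simp add: \<beta>_def max_def)
  have [measurable]: "\<alpha> \<in> borel_measurable M" "\<beta> \<in> borel_measurable M"
    unfolding \<alpha>_def \<beta>_def by measurable
  have i\<alpha>: "integrable M \<alpha>"
  proof (rule Bochner_Integration.integrable_bound)
    show "integrable M (\<lambda>x. 2 / p * phi p (w x))" using bphi bounded_meas_integrable by auto
    show "AE x in M. norm (\<alpha> x) \<le> norm (2 / p * phi p (w x))"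
    proof (rule AE_I2)
      fix x
      show "norm (\<alpha> x) \<le> norm (2 / p * phi p (w x))"
        using \<alpha>0[of x] order_trans[OF \<alpha>_le[of x] abs_ge_self] unfolding real_norm_def by linarith
    qed
  qed measurable
  have iwp: "bounded_meas M (\<lambda>x. w x powr p)"
  proof (rule bounded_measI[of _ _ "B powr p"])
    show "\<bar>w x powr p\<bar> \<le> B powr p" for x
      using powr_mono2[of p "w x" B] w(2)[of x] B(2)[of x] p by simp
  qed measurable
  have i\<beta>: "integrable M \<beta>"
    by (rule Bochner_Integration.integrable_bound[of _ "\<lambda>x. 1 + w x powr p"])
       (use iwp bounded_meas_integrable \<beta>_le \<beta>0 in auto)
  have I\<alpha>: "(\<integral>x. \<alpha> x \<partial>M) \<le> 2 / p * E"
  proof -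
    have "(\<integral>x. \<alpha> x \<partial>M) \<le> (\<integral>x. 2 / p * phi p (w x) \<partial>M)"
      by (intro integral_mono i\<alpha> \<alpha>_le) (use bphi bounded_meas_integrable in auto)
    then show ?thesis by (simp add: E_def)
  qed
  \<comment> \<open>The term linear in \<open>w - 1\<close> drops out because the mean of
    \<open>w\<close> is one.\<close>
  have wp: "(\<integral>x. w x powr p \<partial>M) = 1 + (p - 1) * E"
  proof (cases "p = 1")
    case True then show ?thesis using w1 w by simp
  next
    case False
    have "w x powr p = (p - 1) * phi p (w x) + 1 + p * (w x - 1)" for x
      using False by (simp add: phi_def)
    moreover have "(\<integral>x. ((p - 1) * phi p (w x) + 1) + p * (w x - 1) \<partial>M) = (p - 1) * E + 1"
      using bphi w w1 bounded_meas_integrable by (simp add: E_def prob_space)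
    ultimately show ?thesis by simp
  qed
  have I\<beta>: "(\<integral>x. \<beta> x \<partial>M) \<le> 2 * (1 + (p - 1) * E)"
  proof -
    have "(\<integral>x. \<beta> x \<partial>M) \<le> (\<integral>x. 1 + w x powr p \<partial>M)"
      by (intro integral_mono i\<beta> \<beta>_le) (use iwp bounded_meas_integrable in auto)
    also have "\<dots> = 2 + (p - 1) * E" using iwp bounded_meas_integrable wp by (simp add: prob_space)
    also have "\<dots> \<le> 2 * (1 + (p - 1) * E)" using p E0 by simp
    finally show ?thesis .
  qed
  have split: "\<bar>w x - 1\<bar> powr p = \<alpha> x powr (p / 2) * \<beta> x powr (1 - p / 2)" for x
  proof -
    have "((w x - 1)\<^sup>2) powr (p / 2) = \<bar>w x - 1\<bar> powr p"
    proof (cases "w x = 1")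
      case False
      then have "(w x - 1)\<^sup>2 = \<bar>w x - 1\<bar> powr 2" by (subst powr_numeral) auto
      then show ?thesis by (simp only: powr_powr) simp
    qed simp
    moreover have "(max 1 (w x) powr (p - 2)) powr (p / 2) * \<beta> x powr (1 - p / 2) = 1"
    proof -
      have "(p - 2) * (p / 2) + p * (1 - p / 2) = 0" by (simp add: field_simps)
      then show ?thesis by (simp only: \<beta>_def powr_powr powr_add[symmetric]) simp
    qed
    ultimately show ?thesis by (simp add: \<alpha>_def powr_mult algebra_simps)
  qed
  \<comment> \<open>These bound the integrals of \<alpha> and \<beta>. Hoelder's inequality comes
    from integrating Young's inequality for \<open>\<alpha> x / X\<close> and
    \<open>\<beta> x / Y\<close>; the case \<open>E = 0\<close>, where \<open>X\<close> vanishes, is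
    separate.\<close>
  define X Y where "X = 2 / p * E" and "Y = 2 * (1 + (p - 1) * E)"
  have Y: "1 \<le> Y" using E0 p by (simp add: Y_def)
  have holder: "(\<integral>x. \<bar>w x - 1\<bar> powr p \<partial>M) \<le> X powr (p / 2) * Y powr (1 - p / 2)"
  proof (cases "E = 0")
    case True
    have "0 \<le> (\<integral>x. \<alpha> x \<partial>M)" using \<alpha>0 by simp
    then have "(\<integral>x. \<alpha> x \<partial>M) = 0" using I\<alpha> True by simp
    then have "AE x in M. \<alpha> x = 0"
      using integral_nonneg_eq_0_iff_AE[OF i\<alpha>] \<alpha>0 by simp
    then have "AE x in M. \<bar>w x - 1\<bar> powr p = 0" by eventually_elim (simp add: split)
    then have "(\<integral>x. \<bar>w x - 1\<bar> powr p \<partial>M) = 0" by (simp add: integral_eq_zero_AE)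
    then show ?thesis by simp
  next
    case False
    then have X: "0 < X" using E0 p by (simp add: X_def)
    have young: "\<bar>w x - 1\<bar> powr p \<le> X powr (p / 2) * Y powr (1 - p / 2) *
        (p / 2 * (\<alpha> x / X) + (1 - p / 2) * (\<beta> x / Y))" for x
    proof -
      have "(\<alpha> x / X) powr (p / 2) * (\<beta> x / Y) powr (1 - p / 2) \<le>
          p / 2 * (\<alpha> x / X) + (1 - p / 2) * (\<beta> x / Y)"
      proof (cases "\<alpha> x = 0")
        case True
        then show ?thesis using p Y \<beta>0[of x] by simp
      next
        case False
        then show ?thesis
          using Youngs_inequality_0[of "p / 2" "1 - p / 2" "\<alpha> x / X" "\<beta> x / Y"] p X Y \<alpha>0[of x] \<beta>1[of x]
          by simp
      qed
      then have "X powr (p / 2) * Y powr (1 - p / 2) * ((\<alpha> x / X) powr (p / 2) * (\<beta> x / Y) powr (1 - p / 2)) \<le>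
          X powr (p / 2) * Y powr (1 - p / 2) * (p / 2 * (\<alpha> x / X) + (1 - p / 2) * (\<beta> x / Y))"
        by (intro mult_left_mono) auto
      moreover have "X powr (p / 2) * Y powr (1 - p / 2) * ((\<alpha> x / X) powr (p / 2) * (\<beta> x / Y) powr (1 - p / 2))
          = \<bar>w x - 1\<bar> powr p"
        using X Y \<alpha>0[of x] \<beta>0[of x] by (simp add: split powr_divide)
      ultimately show ?thesis by simp
    qed
    have "(\<integral>x. \<bar>w x - 1\<bar> powr p \<partial>M) \<le> (\<integral>x. X powr (p / 2) * Y powr (1 - p / 2) *
        (p / 2 * (\<alpha> x / X) + (1 - p / 2) * (\<beta> x / Y)) \<partial>M)"
    proof (rule integral_mono')
      show "integrable M (\<lambda>x. X powr (p / 2) * Y powr (1 - p / 2) *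
          (p / 2 * (\<alpha> x / X) + (1 - p / 2) * (\<beta> x / Y)))"
        using i\<alpha> i\<beta> by simp
      show "0 \<le> X powr (p / 2) * Y powr (1 - p / 2) * (p / 2 * (\<alpha> x / X) + (1 - p / 2) * (\<beta> x / Y))" for x
        by (rule order_trans[OF powr_ge_zero young])
    qed (rule young)
    also have "\<dots> = X powr (p / 2) * Y powr (1 - p / 2) *
        (p / 2 * ((\<integral>x. \<alpha> x \<partial>M) / X) + (1 - p / 2) * ((\<integral>x. \<beta> x \<partial>M) / Y))"
      using i\<alpha> i\<beta> by simp
    also have "\<dots> \<le> X powr (p / 2) * Y powr (1 - p / 2) * (p / 2 * 1 + (1 - p / 2) * 1)"
    proof -
      have "(\<integral>x. \<alpha> x \<partial>M) / X \<le> 1" "(\<integral>x. \<beta> x \<partial>M) / Y \<le> 1"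
        using I\<alpha> I\<beta> X Y unfolding X_def[symmetric] Y_def[symmetric] by (simp_all add: divide_le_eq)
      then show ?thesis using p by (intro mult_left_mono add_mono) auto
    qed
    finally show ?thesis by simp
  qed
  have Z: "1 \<le> 1 + (p - 1) * E" using E0 p by simp
  have "X powr (p / 2) * Y powr (1 - p / 2) =
      (2 powr (p / 2) * 2 powr (1 - p / 2)) * (E / p) powr (p / 2) * (1 + (p - 1) * E) powr (1 - p / 2)"
  proof -
    have "X = 2 * (E / p)" by (simp add: X_def)
    then show ?thesis using E0 p Z unfolding Y_def by (simp only: powr_mult mult_ac)
  qed
  also have "\<dots> = 2 * (E / p) powr (p / 2) * (1 + (p - 1) * E) powr (1 - p / 2)"
    by (simp add: powr_add[symmetric])
  \<comment> \<open>A deliberate loss: the base is at least one and so is p. After the root of order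
    p the exponent becomes the \<open>1 - p / 2\<close> of \<open>A_fun\<close>.\<close>
  also have "\<dots> \<le> 2 * (E / p) powr (p / 2) * (1 + (p - 1) * E) powr ((1 - p / 2) * p)"
    using p Z by (intro mult_left_mono powr_mono) (auto simp: mult_le_cancel_left1)
  finally have "(\<integral>x. \<bar>w x - 1\<bar> powr p \<partial>M) \<le>
      2 * (E / p) powr (p / 2) * (1 + (p - 1) * E) powr ((1 - p / 2) * p)"
    using holder by simp
  then have "(\<integral>x. \<bar>w x - 1\<bar> powr p \<partial>M) powr (1 / p) \<le>
      (2 * (E / p) powr (p / 2) * (1 + (p - 1) * E) powr ((1 - p / 2) * p)) powr (1 / p)"
    using p by (intro powr_mono2) auto
  also have "\<dots> = 2 powr (1 / p) * sqrt (E / p) * (1 + (p - 1) * E) powr (1 - p / 2)"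
    using p E0 Z by (simp add: powr_mult powr_powr powr_half_sqrt)
  also have "\<dots> = A_fun p E" by (simp add: A_fun_def real_sqrt_divide)
  finally show ?thesis by (simp add: E_def)
qed

end

section \<open>Operators with symmetric Markov kernels\<close>

definition kernel_op :: "'a measure \<Rightarrow> ('a \<Rightarrow> 'a \<Rightarrow> real) \<Rightarrow> ('a \<Rightarrow> real) \<Rightarrow> 'a \<Rightarrow> real" where
  "kernel_op M K f x = (\<integral>y. K x y * f y \<partial>M)"

text \<open>Strict positivity of the kernel serves the degenerate case of
  \<open>entropy_step\<close>: if \<open>op w x = 0\<close> for a nonnegative \<open>w\<close>, then
  \<open>w\<close> vanishes almost everywhere.\<close>

locale symmetric_markov = prob_space M for M :: "'a measure" +
  fixes K :: "'a \<Rightarrow> 'a \<Rightarrow> real"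
  assumes K_measurable [measurable]: "case_prod K \<in> borel_measurable (M \<Otimes>\<^sub>M M)"
    and K_pos: "0 < K x y"
    and K_sym: "K x y = K y x"
    and K_integrable: "integrable M (K x)"
    and K_integral: "(\<integral>y. K x y \<partial>M) = 1"
begin

abbreviation op :: "('a \<Rightarrow> real) \<Rightarrow> 'a \<Rightarrow> real" where
  "op \<equiv> kernel_op M K"

lemma K_nonneg: "0 \<le> K x y"
  using K_pos[of x y] by simp

lemma K_row [measurable]: "K x \<in> borel_measurable M"
  using K_integrable[of x] by simp

lemma integrable_K_mult:
  assumes "bounded_meas M f"
  shows "integrable M (\<lambda>y. K x y * f y)"
proof -
  obtain B where B: "\<And>x. \<bar>f x\<bar> \<le> B" using assms by (metis bounded_measE)
  have [measurable]: "f \<in> borel_measurable M" using assms by (rule bounded_meas_measurable)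
  show ?thesis
  proof (rule Bochner_Integration.integrable_bound)
    show "integrable M (\<lambda>y. K x y * B)" using K_integrable by simp
    show "AE y in M. norm (K x y * f y) \<le> norm (K x y * B)"
      using B K_nonneg[of x] by (auto simp: abs_mult intro!: mult_left_mono AE_I2 order_trans[OF B])
  qed measurable
qed

lemma op_const: "op (\<lambda>x. c) = (\<lambda>x. c)"
  by (rule ext) (simp add: kernel_op_def K_integral K_integrable)

lemma op_add: "bounded_meas M f \<Longrightarrow> bounded_meas M g \<Longrightarrow> op (\<lambda>x. f x + g x) x = op f x + op g x"
  by (simp add: kernel_op_def distrib_left integrable_K_mult)

lemma op_diff: "bounded_meas M f \<Longrightarrow> bounded_meas M g \<Longrightarrow> op (\<lambda>x. f x - g x) x = op f x - op g x"
  by (simp add: kernel_op_def right_diff_distrib integrable_K_mult)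

lemma op_cmult: "op (\<lambda>x. c * f x) x = c * op f x"
  by (simp add: kernel_op_def mult.left_commute[of _ c])

lemma op_mono:
  assumes "bounded_meas M f" "bounded_meas M g" "\<And>y. f y \<le> g y"
  shows "op f x \<le> op g x"
  unfolding kernel_op_def
  by (intro integral_mono integrable_K_mult assms mult_left_mono K_nonneg)

lemma op_lower: "bounded_meas M f \<Longrightarrow> (\<And>y. c \<le> f y) \<Longrightarrow> c \<le> op f x"
  using op_mono[OF bounded_meas_const, of f c x] by (simp add: op_const)

lemma op_upper: "bounded_meas M f \<Longrightarrow> (\<And>y. f y \<le> c) \<Longrightarrow> op f x \<le> c"
  using op_mono[OF _ bounded_meas_const, of f c x] by (simp add: op_const)

lemma bounded_meas_op:
  assumes "bounded_meas M f"
  shows "bounded_meas M (op f)"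
proof -
  obtain B where B: "\<And>x. \<bar>f x\<bar> \<le> B" using assms by (metis bounded_measE)
  have [measurable]: "f \<in> borel_measurable M" using assms by (rule bounded_meas_measurable)
  have "op f \<in> borel_measurable M" unfolding kernel_op_def by measurable
  moreover have "\<bar>op f x\<bar> \<le> B" for x
    using op_lower[OF assms, of "- B" x] op_upper[OF assms, of B x] B
    by (smt (verit))
  ultimately show ?thesis by (rule bounded_measI)
qed

text \<open>Fubini and the symmetry of the kernel. The double integral converges absolutely because
  the inner integral of the norm is \<open>\<bar>f x\<bar>\<close> times \<open>op\<close> of
  \<open>\<bar>g\<bar>\<close>, which is bounded.\<close>

lemma op_symmetric:
  assumes f: "bounded_meas M f" and g: "bounded_meas M g"
  shows "(\<integral>x. f x * op g x \<partial>M) = (\<integral>x. op f x * g x \<partial>M)"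
proof -
  interpret P: pair_sigma_finite M M ..
  have [measurable]: "f \<in> borel_measurable M" "g \<in> borel_measurable M"
    using f g by (auto dest: bounded_meas_measurable)
  define F where "F x y = f x * (K x y * g y)" for x y
  have [measurable]: "case_prod F \<in> borel_measurable (M \<Otimes>\<^sub>M M)"
    unfolding F_def by measurable
  have Frow: "integrable M (F x)" for x
    unfolding F_def using integrable_K_mult[OF g, of x] by simp
  have "(\<integral>y. norm (F x y) \<partial>M) = \<bar>f x\<bar> * op (\<lambda>y. \<bar>g y\<bar>) x" for x
    by (simp add: F_def kernel_op_def abs_mult K_nonneg)
  moreover have "bounded_meas M (\<lambda>x. \<bar>f x\<bar>)" "bounded_meas M (\<lambda>y. \<bar>g y\<bar>)"
    using f g by (auto simp: bounded_meas_def)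
  ultimately have "integrable M (\<lambda>x. \<integral>y. norm (F x y) \<partial>M)"
    by (simp add: bounded_meas_integrable bounded_meas_mult bounded_meas_op)
  then have int: "integrable (M \<Otimes>\<^sub>M M) (case_prod F)"
    using Frow by (intro P.Fubini_integrable) auto
  have "(\<integral>x. f x * op g x \<partial>M) = (\<integral>x. (\<integral>y. F x y \<partial>M) \<partial>M)"
    by (simp add: kernel_op_def F_def)
  also have "\<dots> = (\<integral>y. (\<integral>x. F x y \<partial>M) \<partial>M)"
    using P.Fubini_integral[OF int] by simp
  also have "\<dots> = (\<integral>x. op f x * g x \<partial>M)"
  proof (rule Bochner_Integration.integral_cong[OF refl])
    fix y
    have "(\<integral>x. F x y \<partial>M) = (\<integral>x. g y * (K y x * f x) \<partial>M)"
      by (simp add: F_def K_sym[of _ y] ac_simps)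
    then show "(\<integral>x. F x y \<partial>M) = op f y * g y" by (simp add: kernel_op_def)
  qed
  finally show ?thesis .
qed

text \<open>Invariance of the measure: self-adjointness tested against the constant 1, which
  \<open>op\<close> fixes.\<close>

lemma integral_op:
  assumes "bounded_meas M f"
  shows "(\<integral>x. op f x \<partial>M) = (\<integral>x. f x \<partial>M)"
  using op_symmetric[OF bounded_meas_const[of M 1] assms] by (simp add: op_const)

text \<open>Jensen's inequality for the probability measure \<open>K x y dM(y)\<close> applied to the convex function
  \<open>\<phi>\<^sub>p - c s\<^sup>2 / 2\<close>, then integrated in \<open>x\<close>.\<close>

lemma entropy_step:
  assumes p: "1 \<le> p" "p \<le> 2" and w: "bounded_meas M w" "\<And>x. 0 \<le> w x" "\<And>x. w x \<le> B"
  shows "p * B powr (p - 2) / 2 * ((\<integral>x. (w x)\<^sup>2 \<partial>M) - (\<integral>x. (op w x)\<^sup>2 \<partial>M))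
    \<le> (\<integral>x. phi p (w x) \<partial>M) - (\<integral>x. phi p (op w x) \<partial>M)"
proof -
  define c where "c = p * B powr (p - 2) / 2"
  have [measurable]: "w \<in> borel_measurable M" using w by (auto dest: bounded_meas_measurable)
  note bow = bounded_meas_op[OF w(1)]
  have ow: "0 \<le> op w x" "op w x \<le> B" for x
    using op_lower[OF w(1,2)] op_upper[OF w(1,3)] by auto
  note bphi = bounded_meas_phi[OF p w(1,2)]
  note bphi' = bounded_meas_phi[OF p bow ow(1)]
  note bi = bounded_meas_intros w(1) bow bphi bphi' bounded_meas_op
  have pt: "phi p (op w x) + c * (op (\<lambda>y. (w y)\<^sup>2) x - (op w x)\<^sup>2) \<le> op (\<lambda>y. phi p (w y)) x" for x
  proof (cases "op w x = 0")
    \<comment> \<open>The strong convexity estimate needs a positive tangent point. Here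
      \<open>w = 0\<close> almost everywhere, and both sides reduce to
      \<open>phi p 0\<close>.\<close>
    case True
    have "AE y in M. K x y * w y = 0"
      using True integral_nonneg_eq_0_iff_AE[OF integrable_K_mult[OF w(1)], of x] K_nonneg w
      by (simp add: kernel_op_def)
    then have w0: "AE y in M. w y = 0" by eventually_elim (use K_pos in \<open>simp add: less_imp_neq[symmetric]\<close>)
    have "op (\<lambda>y. (w y)\<^sup>2) x = (\<integral>y. 0 \<partial>M)" unfolding kernel_op_def
      by (rule integral_cong_AE) (use w0 in auto)
    moreover have "op (\<lambda>y. phi p (w y)) x = (\<integral>y. K x y * phi p 0 \<partial>M)" unfolding kernel_op_def
      by (rule integral_cong_AE) (use w0 in auto)
    ultimately show ?thesis using True p by (simp add: K_integral K_integrable)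
  next
    case False
    define b where "b = op w x"
    have b: "0 < b" "b \<le> B" using False ow[of x] by (auto simp: b_def)
    \<comment> \<open>Since \<open>b\<close> is the mean of \<open>w\<close> under the kernel, the
      tangent term vanishes after averaging and the quadratic term becomes the variance.\<close>
    have "op (\<lambda>y. c * (w y - b)\<^sup>2) x \<le> op (\<lambda>y. (phi p (w y) - phi p b) - dphi p b * (w y - b)) x"
    proof (rule op_mono)
      show "c * (w y - b)\<^sup>2 \<le> (phi p (w y) - phi p b) - dphi p b * (w y - b)" for y
        unfolding c_def by (rule phi_strong_convexity[OF p w(2,3) b])
    qed (intro bi)+
    moreover have "op (\<lambda>y. (phi p (w y) - phi p b) - dphi p b * (w y - b)) x = op (\<lambda>y. phi p (w y)) x - phi p b"
    proof -
      have "op (\<lambda>y. (phi p (w y) - phi p b) - dphi p b * (w y - b)) x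
          = op (\<lambda>y. phi p (w y) - phi p b) x - op (\<lambda>y. dphi p b * (w y - b)) x"
        by (intro op_diff bi)
      also have "op (\<lambda>y. phi p (w y) - phi p b) x = op (\<lambda>y. phi p (w y)) x - phi p b"
        by (subst op_diff) (auto intro!: bi simp: op_const)
      also have "op (\<lambda>y. dphi p b * (w y - b)) x = 0"
        by (subst op_cmult, subst op_diff) (auto intro!: bi simp: op_const b_def)
      finally show ?thesis by simp
    qed
    moreover have "op (\<lambda>y. c * (w y - b)\<^sup>2) x = c * (op (\<lambda>y. (w y)\<^sup>2) x - b\<^sup>2)"
    proof -
      have "op (\<lambda>y. c * (w y - b)\<^sup>2) x = c * op (\<lambda>y. ((w y)\<^sup>2 - 2 * b * w y) + b\<^sup>2) x"
        by (subst op_cmult) (simp add: power2_diff algebra_simps)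
      also have "op (\<lambda>y. ((w y)\<^sup>2 - 2 * b * w y) + b\<^sup>2) x = op (\<lambda>y. (w y)\<^sup>2 - 2 * b * w y) x + b\<^sup>2"
        by (subst op_add) (auto intro!: bi simp: op_const)
      also have "op (\<lambda>y. (w y)\<^sup>2 - 2 * b * w y) x = op (\<lambda>y. (w y)\<^sup>2) x - 2 * b * b"
        by (subst op_diff) (auto intro!: bi simp: op_cmult b_def)
      finally show ?thesis by (simp add: power2_eq_square)
    qed
    ultimately show ?thesis by (simp add: b_def)
  qed
  have "(\<integral>x. phi p (op w x) + c * (op (\<lambda>y. (w y)\<^sup>2) x - (op w x)\<^sup>2) \<partial>M) \<le> (\<integral>x. op (\<lambda>y. phi p (w y)) x \<partial>M)"
    by (intro integral_mono pt bounded_meas_integrable bi)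
  also have "\<dots> = (\<integral>x. phi p (w x) \<partial>M)" by (intro integral_op bi)
  also have "(\<integral>x. phi p (op w x) + c * (op (\<lambda>y. (w y)\<^sup>2) x - (op w x)\<^sup>2) \<partial>M)
      = (\<integral>x. phi p (op w x) \<partial>M) + c * ((\<integral>x. op (\<lambda>y. (w y)\<^sup>2) x \<partial>M) - (\<integral>x. (op w x)\<^sup>2 \<partial>M))"
    by (subst Bochner_Integration.integral_add, (intro bounded_meas_integrable bi)+, simp,
        subst Bochner_Integration.integral_diff, (intro bounded_meas_integrable bi)+, simp)
  also have "(\<integral>x. op (\<lambda>y. (w y)\<^sup>2) x \<partial>M) = (\<integral>x. (w x)\<^sup>2 \<partial>M)" by (intro integral_op bi)
  finally show ?thesis by (simp add: c_def)
qed

lemma bounded_meas_op_funpow: "bounded_meas M g \<Longrightarrow> bounded_meas M ((op ^^ m) g)"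
  by (induction m) (auto intro: bounded_meas_op)

text \<open>With T for \<open>op\<close>, self-adjointness writes the squared norm of T g as the
  inner product of g with T T g. The claim is then the Cauchy-Schwarz inequality, obtained from the
  quadratic polynomial in \<open>l\<close> given by the squared norm of l g - T T g.\<close>

lemma op_log_convex:
  assumes g: "bounded_meas M g"
  shows "(\<integral>x. (op g x)\<^sup>2 \<partial>M)\<^sup>2 \<le> (\<integral>x. (g x)\<^sup>2 \<partial>M) * (\<integral>x. (op (op g) x)\<^sup>2 \<partial>M)"
proof -
  define a0 a1 a2 where "a0 = (\<integral>x. (g x)\<^sup>2 \<partial>M)" and "a1 = (\<integral>x. (op g x)\<^sup>2 \<partial>M)"
    and "a2 = (\<integral>x. (op (op g) x)\<^sup>2 \<partial>M)"
  note bi = bounded_meas_intros g bounded_meas_op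
  have nn: "0 \<le> a0" "0 \<le> a1" "0 \<le> a2" by (auto simp: a0_def a1_def a2_def)
  have a1: "a1 = (\<integral>x. g x * op (op g) x \<partial>M)"
    unfolding a1_def power2_eq_square by (rule op_symmetric[symmetric]) (intro bi)+
  have quad: "2 * l * a1 \<le> l\<^sup>2 * a0 + a2" for l
  proof -
    have "0 \<le> (\<integral>x. (l * g x - op (op g) x)\<^sup>2 \<partial>M)" by simp
    also have "\<dots> = (\<integral>x. (l\<^sup>2 * (g x)\<^sup>2 - 2 * l * (g x * op (op g) x)) + (op (op g) x)\<^sup>2 \<partial>M)"
      by (simp add: power2_diff power_mult_distrib algebra_simps)
    also have "\<dots> = l\<^sup>2 * a0 - 2 * l * a1 + a2"
      unfolding a0_def a1 a2_def
      by (subst Bochner_Integration.integral_add, (intro bounded_meas_integrable bi)+,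
          subst Bochner_Integration.integral_diff, (intro bounded_meas_integrable bi)+, simp)
    finally show ?thesis by simp
  qed
  have "a1\<^sup>2 \<le> a0 * a2"
  proof (cases "a0 = 0")
    case True
    have "a1 = 0"
    proof (rule ccontr)
      assume "a1 \<noteq> 0"
      \<comment> \<open>With \<open>a0 = 0\<close> this choice of \<open>l\<close> turns
        \<open>quad\<close> into \<open>2 * (a2 + 1) \<le> a2\<close>, contradicting
        \<open>0 \<le> a2\<close>.\<close>
      then show False using quad[of "(a2 + 1) / a1"] True nn by simp
    qed
    then show ?thesis using True by simp
  next
    case False
    have "a0 * (2 * (a1 / a0) * a1) \<le> a0 * ((a1 / a0)\<^sup>2 * a0 + a2)"
      using quad[of "a1 / a0"] nn by (intro mult_left_mono)
    then show ?thesis using False by (simp add: power2_eq_square algebra_simps)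
  qed
  then show ?thesis by (simp add: a0_def a1_def a2_def)
qed

text \<open>Log-convexity of the squared norms of the iterates upgrades an asymptotic rate with any
  constant to a one-step contraction with constant one.\<close>

lemma op_contraction:
  assumes g: "bounded_meas M g" and q: "0 < q"
    and decay: "\<And>m. m0 \<le> m \<Longrightarrow> (\<integral>x. ((op ^^ m) g x)\<^sup>2 \<partial>M) \<le> C * q ^ m"
  shows "(\<integral>x. (op g x)\<^sup>2 \<partial>M) \<le> q * (\<integral>x. (g x)\<^sup>2 \<partial>M)"
  using log_convex_decay[of "\<lambda>m. \<integral>x. ((op ^^ m) g x)\<^sup>2 \<partial>M" q m0 C]
    op_log_convex[OF bounded_meas_op_funpow[OF g]] q decay
  by simp

end

text \<open>The Chapman-Kolmogorov relation: exchanging the two integrations lets the composed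
  kernel \<open>J\<close> appear.\<close>

lemma kernel_op_compose:
  assumes "symmetric_markov M K" and "symmetric_markov M L"
    and J: "\<And>z. (\<integral>y. K x y * L y z \<partial>M) = J x z"
    and f: "bounded_meas M f"
  shows "kernel_op M K (kernel_op M L f) x = kernel_op M J f x"
proof -
  interpret K: symmetric_markov M K by fact
  interpret L: symmetric_markov M L by fact
  interpret P: pair_sigma_finite M M ..
  have [measurable]: "f \<in> borel_measurable M" using f by (rule bounded_meas_measurable)
  define F where "F y z = K x y * (L y z * f z)" for y z
  have [measurable]: "case_prod F \<in> borel_measurable (M \<Otimes>\<^sub>M M)"
    unfolding F_def by measurable
  have Frow: "integrable M (F y)" for y
    unfolding F_def using L.integrable_K_mult[OF f, of y] by simp
  have "(\<integral>z. norm (F y z) \<partial>M) = K x y * L.op (\<lambda>z. \<bar>f z\<bar>) y" for y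
    by (simp add: F_def kernel_op_def abs_mult L.K_nonneg K.K_nonneg)
  moreover have "bounded_meas M (\<lambda>z. \<bar>f z\<bar>)" using f by (auto simp: bounded_meas_def)
  ultimately have "integrable M (\<lambda>y. \<integral>z. norm (F y z) \<partial>M)"
    by (simp add: K.integrable_K_mult L.bounded_meas_op)
  then have int: "integrable (M \<Otimes>\<^sub>M M) (case_prod F)"
    using Frow by (intro P.Fubini_integrable) auto
  have "K.op (L.op f) x = (\<integral>y. (\<integral>z. F y z \<partial>M) \<partial>M)"
    by (simp add: kernel_op_def F_def)
  also have "\<dots> = (\<integral>z. (\<integral>y. F y z \<partial>M) \<partial>M)"
    using P.Fubini_integral[OF int] by simp
  also have "\<dots> = (\<integral>z. J x z * f z \<partial>M)"
    by (simp add: F_def J[symmetric] mult.assoc[symmetric])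
  finally show ?thesis by (simp add: kernel_op_def)
qed

section \<open>Gaussian integrals and the Mehler kernel\<close>

lemma Basis_vec_eq: "(Basis :: (real ^ 'd) set) = range (\<lambda>j. axis j 1)"
  by (auto simp: Basis_vec_def)

text \<open>\<open>lborel\<close> is the image of a product measure indexed by the basis vectors,
  whereas the factors are indexed by coordinates. The map \<open>idx\<close> translates between the
  two, and the product integral formula applies.\<close>

lemma has_bochner_integral_prod_coord:
  fixes f :: "'d::finite \<Rightarrow> real \<Rightarrow> real"
  assumes f: "\<And>j. integrable lborel (f j)"
  shows "has_bochner_integral lborel (\<lambda>x :: real ^ 'd. \<Prod>j\<in>UNIV. f j (x $ j))
    (\<Prod>j\<in>UNIV. \<integral>t. f j t \<partial>lborel)"
proof -
  interpret P: product_sigma_finite "\<lambda>_ :: real ^ 'd. lborel :: real measure" ..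
  define idx :: "real ^ 'd \<Rightarrow> 'd" where "idx = inv (\<lambda>j. axis j 1)"
  have inj: "inj (\<lambda>j :: 'd. axis j (1 :: real))" by (rule injI) (simp add: axis_eq_axis)
  have idx: "idx (axis j 1) = j" for j unfolding idx_def using inj by (rule inv_f_f)
  let ?S = "\<lambda>g :: real ^ 'd \<Rightarrow> real. \<Sum>b\<in>Basis. g b *\<^sub>R b"
  let ?P = "\<Pi>\<^sub>M b\<in>(Basis :: (real ^ 'd) set). (lborel :: real measure)"
  have [measurable]: "f j \<in> borel_measurable borel" for j using f[of j] by (auto dest: borel_measurable_integrable)
  have coord: "?S g $ j = g (axis j 1)" for g and j :: 'd
    unfolding Basis_vec_eq
    by (subst sum.reindex[OF inj]) (simp add: axis_def if_distrib cong: if_cong)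
  have prod_eq: "(\<Prod>j\<in>UNIV. f j (?S g $ j)) = (\<Prod>b\<in>Basis. f (idx b) (g b))" for g
    unfolding coord unfolding Basis_vec_eq
    by (subst prod.reindex[OF inj]) (simp add: idx)
  have meas: "?S \<in> measurable ?P borel" by measurable
  have measF: "(\<lambda>x :: real ^ 'd. \<Prod>j\<in>UNIV. f j (x $ j)) \<in> borel_measurable borel" by measurable
  have "integrable ?P (\<lambda>g. \<Prod>b\<in>Basis. f (idx b) (g b))"
    by (intro P.product_integrable_prod f) auto
  moreover have "(\<integral>g. (\<Prod>b\<in>Basis. f (idx b) (g b)) \<partial>?P) = (\<Prod>b\<in>Basis. \<integral>t. f (idx b) t \<partial>lborel)"
    by (intro P.product_integral_prod f) auto
  moreover have "(\<Prod>b\<in>(Basis :: (real ^ 'd) set). \<integral>t. f (idx b) t \<partial>lborel) = (\<Prod>j\<in>UNIV. \<integral>t. f j t \<partial>lborel)"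
    unfolding Basis_vec_eq by (subst prod.reindex[OF inj]) (simp add: idx)
  ultimately show ?thesis
    unfolding has_bochner_integral_iff
    by (subst (1 2) lborel_eq) (simp only: integrable_distr_eq[OF meas measF] integral_distr[OF meas measF] prod_eq)
qed

text \<open>Completing the square turns the integrand into a multiple of the normal density of mean
  \<open>b / a\<close> and standard deviation \<open>1 / sqrt a\<close>.\<close>

lemma has_bochner_integral_gaussian_real:
  fixes a b :: real
  assumes a: "0 < a"
  shows "has_bochner_integral lborel (\<lambda>t. exp (- a * t\<^sup>2 / 2 + b * t))
    (sqrt (2 * pi / a) * exp (b\<^sup>2 / (2 * a)))"
proof -
  define c where "c = sqrt (2 * pi / a) * exp (b\<^sup>2 / (2 * a))"
  have "has_bochner_integral lborel (\<lambda>t. c * normal_density (b / a) (1 / sqrt a) t) (c * 1)"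
    using a by (intro has_bochner_integral_mult_right) (simp_all add: has_bochner_integral_iff)
  moreover have "c * normal_density (b / a) (1 / sqrt a) t = exp (- a * t\<^sup>2 / 2 + b * t)" for t
  proof -
    have 1: "b\<^sup>2 / (2 * a) + - (t - b / a)\<^sup>2 / (2 * (1 / sqrt a)\<^sup>2) = - a * t\<^sup>2 / 2 + b * t"
      using a by (simp add: power_divide power2_diff field_simps power2_eq_square)
    have "c * normal_density (b / a) (1 / sqrt a) t =
        exp (b\<^sup>2 / (2 * a)) * exp (- (t - b / a)\<^sup>2 / (2 * (1 / sqrt a)\<^sup>2))"
      using a by (simp add: c_def normal_density_def power_divide real_sqrt_divide)
    then show ?thesis by (simp only: exp_add[symmetric] 1)
  qed
  ultimately show ?thesis by (simp add: c_def)
qed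

lemma norm_power2_vec: "(norm (x :: real ^ 'd))\<^sup>2 = (\<Sum>j\<in>UNIV. (x $ j)\<^sup>2)"
  by (simp add: norm_eq_sqrt_inner inner_vec_def power2_eq_square sum_nonneg)

lemma inner_vec_real: "(x :: real ^ 'd) \<bullet> y = (\<Sum>j\<in>UNIV. x $ j * y $ j)"
  by (simp add: inner_vec_def)

lemma has_bochner_integral_gaussian:
  fixes b :: "real ^ 'd"
  assumes a: "0 < a"
  shows "has_bochner_integral lborel (\<lambda>y. exp (- a * (norm y)\<^sup>2 / 2 + b \<bullet> y))
    ((2 * pi / a) powr (real CARD('d) / 2) * exp ((norm b)\<^sup>2 / (2 * a)))"
proof -
  have "has_bochner_integral lborel (\<lambda>y :: real ^ 'd. \<Prod>j\<in>UNIV. exp (- a * (y $ j)\<^sup>2 / 2 + b $ j * (y $ j)))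
      (\<Prod>j\<in>UNIV. \<integral>t. exp (- a * t\<^sup>2 / 2 + b $ j * t) \<partial>lborel)"
    by (rule has_bochner_integral_prod_coord) (rule has_bochner_integral_gaussian_real[OF a, THEN integrable.intros])
  moreover have "(\<integral>t. exp (- a * t\<^sup>2 / 2 + c * t) \<partial>lborel) = sqrt (2 * pi / a) * exp (c\<^sup>2 / (2 * a))" for c
    using has_bochner_integral_gaussian_real[OF a] by (rule has_bochner_integral_integral_eq)
  moreover have "(\<Prod>j\<in>(UNIV :: 'd set). sqrt (2 * pi / a) * exp ((b $ j)\<^sup>2 / (2 * a))) =
      (2 * pi / a) powr (real CARD('d) / 2) * exp ((norm b)\<^sup>2 / (2 * a))"
  proof -
    have "(\<Prod>j\<in>(UNIV :: 'd set). sqrt (2 * pi / a)) = (2 * pi / a) powr (real CARD('d) / 2)"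
      using a by (simp add: powr_half_sqrt[symmetric] powr_realpow[symmetric] powr_powr)
    then show ?thesis
      by (simp add: prod.distrib exp_sum[symmetric] norm_power2_vec sum_divide_distrib)
  qed
  moreover have "(\<Prod>j\<in>UNIV. exp (- a * (y $ j)\<^sup>2 / 2 + b $ j * (y $ j))) = exp (- a * (norm y)\<^sup>2 / 2 + b \<bullet> y)" for y
    by (simp add: exp_sum[symmetric] norm_power2_vec inner_vec_real sum.distrib sum_distrib_left sum_divide_distrib sum_negf sum_subtractf)
  ultimately show ?thesis by simp
qed

section \<open>The Gaussian measure and Mehler's formula\<close>

lemma v_infty_pos: "0 < v_infty x"
  by (simp add: v_infty_def)

lemma v_infty_nonneg [simp]: "0 \<le> v_infty x"
  by (simp add: v_infty_def)

lemma v_infty_measurable [measurable]: "v_infty \<in> borel_measurable borel"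
  unfolding v_infty_def by measurable

lemma space_gauss [simp]: "space gauss_measure = UNIV"
  and sets_gauss [simp, measurable_cong]: "sets gauss_measure = sets borel"
  by (simp_all add: gauss_measure_def)

lemma borel_measurable_gauss [simp]: "borel_measurable gauss_measure = borel_measurable borel"
  by (rule measurable_cong_sets) simp_all

lemma AE_gauss: "(AE x in gauss_measure. P x) \<longleftrightarrow> (AE x in lborel. P x)"
  unfolding gauss_measure_def by (subst AE_density) (simp_all add: v_infty_pos)

lemma has_bochner_integral_gauss:
  fixes f :: "real ^ 'd \<Rightarrow> real"
  assumes "f \<in> borel_measurable borel"
  shows "has_bochner_integral gauss_measure f c \<longleftrightarrow> has_bochner_integral lborel (\<lambda>x. v_infty x * f x) c"
  using assms unfolding gauss_measure_def has_bochner_integral_iff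
  by (auto simp: integrable_density integral_density)

lemma integral_gauss:
  fixes f :: "real ^ 'd \<Rightarrow> real"
  assumes "f \<in> borel_measurable borel"
  shows "(\<integral>x. f x \<partial>gauss_measure) = (\<integral>x. v_infty x * f x \<partial>lborel)"
  using assms unfolding gauss_measure_def by (auto simp: integral_density)

text \<open>The source of all integrals of Gaussian type below. Negative \<open>a\<close> down to -1
  is allowed because growing exponentials such as \<open>exp ((norm y)\<^sup>2 / 4)\<close> occur as
  majorants.\<close>

lemma gauss_exp_quadratic:
  fixes b :: "real ^ 'd"
  assumes a: "0 < 1 + a"
  shows "has_bochner_integral gauss_measure (\<lambda>y. exp (- a * (norm y)\<^sup>2 / 2 + b \<bullet> y))
    ((1 + a) powr (- real CARD('d) / 2) * exp ((norm b)\<^sup>2 / (2 * (1 + a))))"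
proof -
  let ?c = "(2 * pi) powr (- real CARD('d) / 2)"
  have "has_bochner_integral lborel (\<lambda>y. ?c * exp (- (1 + a) * (norm y)\<^sup>2 / 2 + b \<bullet> y))
      (?c * ((2 * pi / (1 + a)) powr (real CARD('d) / 2) * exp ((norm b)\<^sup>2 / (2 * (1 + a)))))"
    by (intro has_bochner_integral_mult_right has_bochner_integral_gaussian a)
  moreover have "?c * (2 * pi / (1 + a)) powr (real CARD('d) / 2) = (1 + a) powr (- real CARD('d) / 2)"
    using a by (simp add: powr_divide powr_minus field_simps)
  moreover have "?c * exp (- (1 + a) * (norm y)\<^sup>2 / 2 + b \<bullet> y) = v_infty y * exp (- a * (norm y)\<^sup>2 / 2 + b \<bullet> y)" for y
    by (simp add: v_infty_def exp_add[symmetric] field_simps)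
  ultimately show ?thesis
    by (subst has_bochner_integral_gauss) (simp_all add: mult.assoc[symmetric])
qed

lemma prob_space_gauss: "prob_space (gauss_measure :: (real ^ 'd) measure)"
proof
  have "has_bochner_integral gauss_measure (\<lambda>y :: real ^ 'd. 1 :: real) 1"
    using gauss_exp_quadratic[of 0 "0 :: real ^ 'd"] by simp
  then have "has_bochner_integral lborel (v_infty :: real ^ 'd \<Rightarrow> real) 1"
    by (subst (asm) has_bochner_integral_gauss) simp_all
  then have "(\<integral>\<^sup>+x. ennreal (v_infty (x :: real ^ 'd)) \<partial>lborel) = 1"
    by (simp add: has_bochner_integral_iff nn_integral_eq_integral)
  then show "emeasure (gauss_measure :: (real ^ 'd) measure) (space gauss_measure) = 1"
    by (simp add: gauss_measure_def emeasure_density)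
qed

interpretation gauss: prob_space "gauss_measure :: (real ^ 'd) measure"
  by (rule prob_space_gauss)

text \<open>The density, with respect to the Gaussian measure in \<open>y\<close>, of the law of
  \<open>\<rho> x + sqrt (1 - \<rho>\<^sup>2) Z\<close> for a standard normal \<open>Z\<close>; the Ornstein--Uhlenbeck semigroup at
  time \<open>s\<close> is the case \<open>\<rho> = exp (- s)\<close>.\<close>

definition mehler :: "real \<Rightarrow> real ^ 'd \<Rightarrow> real ^ 'd \<Rightarrow> real" where
  "mehler \<rho> x y = (1 - \<rho>\<^sup>2) powr (- real CARD('d) / 2) *
     exp (- (\<rho>\<^sup>2 * (norm x)\<^sup>2 + \<rho>\<^sup>2 * (norm y)\<^sup>2 - 2 * \<rho> * (x \<bullet> y)) / (2 * (1 - \<rho>\<^sup>2)))"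

text \<open>For fixed \<open>x\<close> the last factor has the form integrated by
  \<open>gauss_exp_quadratic\<close>; the other factors do not depend on \<open>y\<close>.\<close>

lemma mehler_eq:
  "mehler \<rho> x (y :: real ^ 'd) = (1 - \<rho>\<^sup>2) powr (- real CARD('d) / 2) *
     exp (- \<rho>\<^sup>2 * (norm x)\<^sup>2 / (2 * (1 - \<rho>\<^sup>2))) *
     exp (- (\<rho>\<^sup>2 / (1 - \<rho>\<^sup>2)) * (norm y)\<^sup>2 / 2 + ((\<rho> / (1 - \<rho>\<^sup>2)) *\<^sub>R x) \<bullet> y)"
proof -
  have e: "- (\<rho>\<^sup>2 * A + \<rho>\<^sup>2 * B - 2 * \<rho> * c) / (2 * r) =
      - \<rho>\<^sup>2 * A / (2 * r) + (- (\<rho>\<^sup>2 / r) * B / 2 + \<rho> / r * c)" for A B c r :: real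
    by (cases "r = 0") (simp_all add: field_simps)
  then show ?thesis
    unfolding mehler_def inner_scaleR_left e exp_add by (simp only: mult_ac)
qed

lemma square_less_1: "0 < \<rho> \<Longrightarrow> \<rho> < 1 \<Longrightarrow> 0 < 1 - (\<rho> :: real)\<^sup>2"
  using power_strict_mono[of \<rho> 1 2] by simp

lemma mehler_integral:
  assumes \<rho>: "0 < \<rho>" "\<rho> < 1"
  shows "has_bochner_integral gauss_measure (mehler \<rho> (x :: real ^ 'd)) 1"
proof -
  define r where "r = 1 - \<rho>\<^sup>2"
  have r: "0 < r" using square_less_1[OF \<rho>] by (simp add: r_def)
  have a: "1 + \<rho>\<^sup>2 / r = 1 / r" using r by (simp add: r_def field_simps)
  let ?c = "r powr (- real CARD('d) / 2) * exp (- \<rho>\<^sup>2 * (norm x)\<^sup>2 / (2 * r))"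
  have "has_bochner_integral gauss_measure
      (\<lambda>y. ?c * exp (- (\<rho>\<^sup>2 / r) * (norm y)\<^sup>2 / 2 + ((\<rho> / r) *\<^sub>R x) \<bullet> y))
      (?c * ((1 / r) powr (- real CARD('d) / 2) * exp ((norm ((\<rho> / r) *\<^sub>R x))\<^sup>2 / (2 * (1 / r)))))"
    using gauss_exp_quadratic[of "\<rho>\<^sup>2 / r" "(\<rho> / r) *\<^sub>R x"] r unfolding a
    by (intro has_bochner_integral_mult_right) simp
  moreover have "(norm ((\<rho> / r) *\<^sub>R x))\<^sup>2 / (2 * (1 / r)) = \<rho>\<^sup>2 * (norm x)\<^sup>2 / (2 * r)"
    using r by (simp add: power_mult_distrib power_divide power2_eq_square field_simps)
  moreover have "r powr (- real CARD('d) / 2) * (1 / r) powr (- real CARD('d) / 2) = 1"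
    using r by (simp add: powr_mult[symmetric])
  ultimately show ?thesis
    unfolding mehler_eq[abs_def] r_def[symmetric]
    by (simp add: mult.assoc mult.left_commute exp_add[symmetric])
qed

text \<open>In the middle variable the product of the kernels is an exponential with quadratic
  coefficient \<open>a\<close> and linear coefficient \<open>b\<close>. Integrating it and comparing
  exponents gives the kernel with parameter \<open>\<rho> * \<sigma>\<close>.\<close>

lemma mehler_semigroup:
  assumes \<rho>: "0 < \<rho>" "\<rho> < 1" and \<sigma>: "0 < \<sigma>" "\<sigma> < 1"
  shows "(\<integral>y. mehler \<rho> x y * mehler \<sigma> y z \<partial>gauss_measure) = mehler (\<rho> * \<sigma>) x (z :: real ^ 'd)"
proof -
  define r s t where "r = 1 - \<rho>\<^sup>2" and "s = 1 - \<sigma>\<^sup>2" and "t = 1 - (\<rho> * \<sigma>)\<^sup>2"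
  have pos: "0 < r" "0 < s" "0 < t"
    using square_less_1 \<rho> \<sigma> mult_strict_mono[of \<rho> 1 \<sigma> 1] by (auto simp: r_def s_def t_def)
  define a where "a = \<rho>\<^sup>2 / r + \<sigma>\<^sup>2 / s"
  define b where "b = (\<rho> / r) *\<^sub>R x + (\<sigma> / s) *\<^sub>R z"
  have a: "1 + a = t / (r * s)"
    using pos by (simp add: a_def divide_simps) (simp add: r_def s_def t_def algebra_simps power_mult_distrib)
  let ?d = "- real CARD('d) / 2"
  let ?c = "r powr ?d * s powr ?d * exp (- \<rho>\<^sup>2 * (norm x)\<^sup>2 / (2 * r) + - \<sigma>\<^sup>2 * (norm z)\<^sup>2 / (2 * s))"
  have "mehler \<rho> x y * mehler \<sigma> y z = ?c * exp (- a * (norm y)\<^sup>2 / 2 + b \<bullet> y)" for y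
  proof -
    have "mehler \<sigma> y z = s powr ?d * exp (- \<sigma>\<^sup>2 * (norm z)\<^sup>2 / (2 * s)) *
        exp (- (\<sigma>\<^sup>2 / s) * (norm y)\<^sup>2 / 2 + ((\<sigma> / s) *\<^sub>R z) \<bullet> y)"
      using mehler_eq[of \<sigma> z y] by (simp add: mehler_def s_def algebra_simps inner_commute)
    moreover have "- (\<rho>\<^sup>2 / r) * (norm y)\<^sup>2 / 2 + ((\<rho> / r) *\<^sub>R x) \<bullet> y + (- (\<sigma>\<^sup>2 / s) * (norm y)\<^sup>2 / 2 + ((\<sigma> / s) *\<^sub>R z) \<bullet> y)
        = - a * (norm y)\<^sup>2 / 2 + b \<bullet> y"
      using pos by (simp add: a_def b_def inner_add_left field_simps)
    ultimately show ?thesis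
      unfolding mehler_eq[of \<rho> x y] r_def[symmetric]
      by (simp only: exp_add[symmetric] mult_ac)
         (simp add: exp_add[symmetric] mult.assoc mult.left_commute)
  qed
  then have "(\<integral>y. mehler \<rho> x y * mehler \<sigma> y z \<partial>gauss_measure) =
      ?c * ((t / (r * s)) powr ?d * exp ((norm b)\<^sup>2 / (2 * (t / (r * s)))))"
    using has_bochner_integral_integral_eq[OF gauss_exp_quadratic[of a b]] pos by (simp add: a)
  also have "\<dots> = (r powr ?d * s powr ?d * (t / (r * s)) powr ?d) *
      exp (- \<rho>\<^sup>2 * (norm x)\<^sup>2 / (2 * r) + - \<sigma>\<^sup>2 * (norm z)\<^sup>2 / (2 * s) + (norm b)\<^sup>2 / (2 * (t / (r * s))))"
    by (simp only: exp_add mult_ac)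
  also have "r powr ?d * s powr ?d * (t / (r * s)) powr ?d = t powr ?d"
    using pos by (simp add: powr_mult[symmetric])
  also have "- \<rho>\<^sup>2 * (norm x)\<^sup>2 / (2 * r) + - \<sigma>\<^sup>2 * (norm z)\<^sup>2 / (2 * s) + (norm b)\<^sup>2 / (2 * (t / (r * s))) =
      - ((\<rho> * \<sigma>)\<^sup>2 * (norm x)\<^sup>2 + (\<rho> * \<sigma>)\<^sup>2 * (norm z)\<^sup>2 - 2 * (\<rho> * \<sigma>) * (x \<bullet> z)) / (2 * t)"
  proof -
    have b: "(norm b)\<^sup>2 = (\<rho> / r)\<^sup>2 * (norm x)\<^sup>2 + 2 * (\<rho> / r) * (\<sigma> / s) * (x \<bullet> z) + (\<sigma> / s)\<^sup>2 * (norm z)\<^sup>2"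
      unfolding b_def power2_norm_eq_inner
      by (simp add: inner_add_left inner_add_right inner_commute power2_eq_square algebra_simps)
    \<comment> \<open>The first decomposition of \<open>t\<close> matches the coefficient of the
      squared norm of \<open>x\<close>, the second that of \<open>z\<close>.\<close>
    have t1: "t = s + \<sigma>\<^sup>2 * r" and t2: "t = r + \<rho>\<^sup>2 * s"
      by (simp_all add: r_def s_def t_def algebra_simps power_mult_distrib)
    have c1: "(\<rho> / r)\<^sup>2 * A / (2 * (t / (r * s))) = \<rho>\<^sup>2 * A / (2 * r) - (\<rho> * \<sigma>)\<^sup>2 * A / (2 * t)" for A
    proof -
      have "(\<rho> / r)\<^sup>2 * A / (2 * (t / (r * s))) = \<rho>\<^sup>2 * A * s / (2 * r * t)"
        using pos by (simp add: power_divide power2_eq_square)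
      also have "\<dots> = \<rho>\<^sup>2 * A * (t - \<sigma>\<^sup>2 * r) / (2 * r * t)" using t1 by simp
      also have "\<dots> = \<rho>\<^sup>2 * A / (2 * r) - (\<rho> * \<sigma>)\<^sup>2 * A / (2 * t)"
        using pos by (simp add: field_simps)
      finally show ?thesis .
    qed
    have c2: "(\<sigma> / s)\<^sup>2 * A / (2 * (t / (r * s))) = \<sigma>\<^sup>2 * A / (2 * s) - (\<rho> * \<sigma>)\<^sup>2 * A / (2 * t)" for A
    proof -
      have "(\<sigma> / s)\<^sup>2 * A / (2 * (t / (r * s))) = \<sigma>\<^sup>2 * A * r / (2 * s * t)"
        using pos by (simp add: power_divide power2_eq_square)
      also have "\<dots> = \<sigma>\<^sup>2 * A * (t - \<rho>\<^sup>2 * s) / (2 * s * t)" using t2 by simp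
      also have "\<dots> = \<sigma>\<^sup>2 * A / (2 * s) - (\<rho> * \<sigma>)\<^sup>2 * A / (2 * t)"
        using pos by (simp add: field_simps)
      finally show ?thesis .
    qed
    have c3: "2 * (\<rho> / r) * (\<sigma> / s) * A / (2 * (t / (r * s))) = \<rho> * \<sigma> * A / t" for A
      using pos by simp
    show ?thesis
      unfolding b add_divide_distrib c1 c2 c3 using pos by (simp add: diff_divide_distrib add_divide_distrib)
  qed
  finally show ?thesis by (simp add: mehler_def t_def)
qed

lemma symmetric_markov_mehler:
  assumes \<rho>: "0 < \<rho>" "\<rho> < 1"
  shows "symmetric_markov (gauss_measure :: (real ^ 'd) measure) (mehler \<rho>)"
proof
  show "case_prod (mehler \<rho>) \<in> borel_measurable ((gauss_measure :: (real ^ 'd) measure) \<Otimes>\<^sub>M gauss_measure)"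
    unfolding mehler_def by measurable
  fix x y :: "real ^ 'd"
  show "0 < mehler \<rho> x y" using square_less_1[OF \<rho>] by (simp add: mehler_def)
  show "mehler \<rho> x y = mehler \<rho> y x" by (simp add: mehler_def inner_commute add.commute)
  show "integrable gauss_measure (mehler \<rho> x)" "(\<integral>y. mehler \<rho> x y \<partial>gauss_measure) = 1"
    using mehler_integral[OF \<rho>, of x] by (auto simp: has_bochner_integral_iff)
qed

section \<open>Hermite polynomials\<close>

text \<open>The unnormalized probabilists' Hermite polynomial times \<open>(-1) ^ m\<close>, that
  is, the polynomial factor of the \<open>m\<close>-th derivative of
  \<open>exp (- z\<^sup>2 / 2)\<close>.\<close>

fun herm_poly :: "nat \<Rightarrow> real poly" where
  "herm_poly 0 = 1"
| "herm_poly (Suc m) = pderiv (herm_poly m) - [:0, 1:] * herm_poly m"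

lemma deriv_gauss: "(deriv ^^ m) (\<lambda>z. exp (- z\<^sup>2 / 2)) = (\<lambda>z. poly (herm_poly m) z * exp (- z\<^sup>2 / 2))"
proof (induction m)
  case (Suc m)
  have "((\<lambda>z. poly (herm_poly m) z * exp (- z\<^sup>2 / 2)) has_real_derivative
      poly (herm_poly (Suc m)) z * exp (- z\<^sup>2 / 2)) (at z)" for z
    by (auto intro!: derivative_eq_intros simp: algebra_simps)
  then show ?case using Suc by (auto intro!: ext DERIV_imp_deriv)
qed simp

lemma pderiv_herm_poly: "pderiv (herm_poly (Suc m)) = smult (- real (Suc m)) (herm_poly m)"
proof (induction m)
  case (Suc m)
  have "pderiv (herm_poly (Suc (Suc m))) =
      pderiv (pderiv (herm_poly (Suc m))) - (herm_poly (Suc m) + [:0, 1:] * pderiv (herm_poly (Suc m)))"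
    unfolding herm_poly.simps(2)[of "Suc m"] pderiv_diff pderiv_mult by (simp add: pderiv_pCons)
  also have "\<dots> = smult (- real (Suc m)) (pderiv (herm_poly m) - [:0, 1:] * herm_poly m) - herm_poly (Suc m)"
    unfolding Suc.IH pderiv_smult by (simp add: smult_diff_right)
  also have "\<dots> = smult (- real (Suc m)) (herm_poly (Suc m)) - smult 1 (herm_poly (Suc m))" by simp
  also have "\<dots> = smult (- real (Suc (Suc m))) (herm_poly (Suc m))"
    by (simp only: smult_diff_left[symmetric]) simp
  finally show ?case .
qed (simp add: pderiv_pCons)

definition herm_coeff :: "nat \<Rightarrow> real" where
  "herm_coeff m = (- 1) ^ m * (fact m) powr (- 1 / 2)"

lemma herm_coeff_nonzero: "herm_coeff m \<noteq> 0"
  by (simp add: herm_coeff_def)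

lemma hermite_eq: "hermite m y = herm_coeff m * poly (herm_poly m) y"
proof -
  have "exp (y\<^sup>2 / 2) * (poly (herm_poly m) y * exp (- y\<^sup>2 / 2)) = poly (herm_poly m) y"
    by (simp add: exp_minus)
  then show ?thesis by (simp only: hermite_def deriv_gauss herm_coeff_def mult.assoc)
qed

lemma hermite_0 [simp]: "hermite 0 y = 1"
  by (simp add: hermite_eq herm_coeff_def)

text \<open>The three-term recurrence; only the existence of coefficients matters. At
  \<open>m = 0\<close> the truncated index \<open>m - 1\<close> is harmless, since the derivative it
  stands for is zero and \<open>b = 0\<close> can be taken.\<close>

lemma hermite_recurrence: "\<exists>a b. \<forall>y. y * hermite m y = a * hermite (Suc m) y + b * hermite (m - 1) y"
proof -
  have "\<exists>b. \<forall>y. poly (pderiv (herm_poly m)) y = b * poly (herm_poly (m - 1)) y"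
  proof (cases m)
    case (Suc k) then show ?thesis using pderiv_herm_poly[of k] by (auto intro!: exI[of _ "- real (Suc k)"])
  qed (auto intro!: exI[of _ 0])
  then obtain b where b: "\<And>y. poly (pderiv (herm_poly m)) y = b * poly (herm_poly (m - 1)) y" by blast
  have rec: "y * poly (herm_poly m) y = b * poly (herm_poly (m - 1)) y - poly (herm_poly (Suc m)) y" for y
    by (simp add: b)
  show ?thesis
  proof (intro exI allI)
    fix y
    show "y * hermite m y = (- herm_coeff m / herm_coeff (Suc m)) * hermite (Suc m) y
        + (herm_coeff m * b / herm_coeff (m - 1)) * hermite (m - 1) y"
      using rec[of y] herm_coeff_nonzero[of "Suc m"] herm_coeff_nonzero[of "m - 1"]
      unfolding hermite_eq by (simp add: mult.left_commute[of y] right_diff_distrib)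
  qed
qed

lemma hermite_measurable [measurable]: "hermite m \<in> borel_measurable borel"
  unfolding hermite_eq[abs_def] by (intro borel_measurable_continuous_onI continuous_intros)

lemma multi_hermite_measurable [measurable]: "multi_hermite k \<in> borel_measurable borel"
  unfolding multi_hermite_def by measurable

lemma multi_hermite_0 [simp]: "multi_hermite (\<lambda>_. 0) x = 1"
  by (simp add: multi_hermite_def)

section \<open>Gaussian integrals of polynomials and of Hermite polynomials\<close>

lemma integrable_std_normal_poly: "integrable lborel (\<lambda>x. std_normal_density x * poly P x)"
  unfolding poly_altdef sum_distrib_left
  by (intro Bochner_Integration.integrable_sum)
     (simp add: mult.left_commute integrable_std_normal_moment)

text \<open>Read off from the closed forms: for even \<open>k\<close> both odd moments vanish (the
  factor \<open>k\<close> covers \<open>k = 0\<close>), and for odd \<open>k\<close> the factorials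
  cancel.\<close>

lemma std_normal_moment_recurrence:
  "(\<integral>x. std_normal_density x * x ^ Suc k \<partial>lborel) = real k * (\<integral>x. std_normal_density x * x ^ (k - 1) \<partial>lborel)"
proof (cases "even k")
  case True
  then obtain i where k: "k = 2 * i" by auto
  show ?thesis
  proof (cases i)
    case 0 then show ?thesis using integral_std_normal_moment_odd[of 0] by (simp add: k)
  next
    case (Suc j)
    then have "k - 1 = 2 * j + 1" "Suc k = 2 * i + 1" using k by auto
    then show ?thesis by (simp only: integral_std_normal_moment_odd mult_zero_right)
  qed
next
  case False
  then obtain j where k: "k = 2 * j + 1" using oddE by blast
  have "Suc k = 2 * Suc j" "k - 1 = 2 * j" using k by auto
  then show ?thesis
  proof (simp only: integral_std_normal_moment_even)
    have 1: "fact (2 * Suc j) = (2 * (real j + 1)) * ((2 * real j + 1) * fact (2 * j))"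
      by (simp add: algebra_simps)
    have 2: "2 ^ Suc j * fact (Suc j) = (2 * (real j + 1)) * (2 ^ j * fact j)" by (simp add: algebra_simps)
    have "2 * (real j + 1) \<noteq> 0" by simp
    then have "fact (2 * Suc j) / (2 ^ Suc j * fact (Suc j)) = ((2 * real j + 1) * fact (2 * j)) / (2 ^ j * fact j)"
      unfolding 1 2 by (rule mult_divide_mult_cancel_left)
    then show "fact (2 * Suc j) / (2 ^ Suc j * fact (Suc j)) = real k * (fact (2 * j) / (2 ^ j * fact j))"
      by (simp add: k)
  qed
qed

text \<open>Both sides are linear in \<open>P\<close>, and on monomials the identity is the moment
  recurrence.\<close>

lemma std_normal_integral_by_parts:
  "(\<integral>x. std_normal_density x * poly (pderiv P - [:0, 1:] * P) x \<partial>lborel) = 0"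
proof -
  define I where "I Q = (\<integral>x. std_normal_density x * poly Q x \<partial>lborel)" for Q
  have add: "I (Q + R) = I Q + I R" for Q R
    unfolding I_def by (simp add: distrib_left integrable_std_normal_poly)
  define L where "L Q = I (pderiv Q - [:0, 1:] * Q)" for Q
  have Ladd: "L (Q + R) = L Q + L R" for Q R
  proof -
    have "pderiv (Q + R) - [:0, 1:] * (Q + R) = (pderiv Q - [:0, 1:] * Q) + (pderiv R - [:0, 1:] * R)"
      by (simp add: pderiv_add algebra_simps del: mult_pCons_left)
    then show ?thesis by (simp only: L_def add)
  qed
  have L0: "L 0 = 0" by (simp add: L_def I_def)
  have mono: "I (pderiv (monom c i) - [:0, 1:] * monom c i) = 0" for c i
  proof -
    have eq: "poly (pderiv (monom c i) - [:0, 1:] * monom c i) x = c * (real i * x ^ (i - 1)) - c * x ^ Suc i" for x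
      by (simp add: pderiv_monom poly_monom)
    have "I (pderiv (monom c i) - [:0, 1:] * monom c i) =
        (\<integral>x. c * (real i * (std_normal_density x * x ^ (i - 1))) - c * (std_normal_density x * x ^ Suc i) \<partial>lborel)"
      by (simp only: I_def eq) (simp add: algebra_simps del: power_Suc)
    also have "\<dots> = c * (real i * (\<integral>x. std_normal_density x * x ^ (i - 1) \<partial>lborel)) -
        c * (\<integral>x. std_normal_density x * x ^ Suc i \<partial>lborel)"
      by (subst Bochner_Integration.integral_diff) (auto intro: integrable_std_normal_moment simp del: power_Suc)
    finally show ?thesis by (simp add: std_normal_moment_recurrence del: power_Suc)
  qed
  have "L (\<Sum>i\<in>A. monom (coeff P i) i) = 0" if "finite A" for A
    using that by (induction A) (simp_all add: L0 Ladd mono[folded L_def])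
  then have "L P = 0" using poly_as_sum_of_monoms[of P] by (metis finite_atMost)
  then show ?thesis by (simp add: L_def I_def)
qed

lemma integrable_std_normal_hermite: "integrable lborel (\<lambda>x. std_normal_density x * hermite m x)"
  unfolding hermite_eq by (simp add: mult.left_commute integrable_std_normal_poly)

lemma integral_std_normal_hermite: "0 < m \<Longrightarrow> (\<integral>x. std_normal_density x * hermite m x \<partial>lborel) = 0"
  using std_normal_integral_by_parts[of "herm_poly (m - 1)"] unfolding hermite_eq
  by (cases m) (simp_all add: mult.left_commute)

lemma multi_hermite_gauss:
  "has_bochner_integral gauss_measure (multi_hermite (k :: 'd::finite \<Rightarrow> nat))
    (\<Prod>j\<in>UNIV. \<integral>x. std_normal_density x * hermite (k j) x \<partial>lborel)"
proof -
  have v: "v_infty (x :: real ^ 'd) = (\<Prod>j\<in>UNIV. std_normal_density (x $ j))" for x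
  proof -
    have "(2 * pi) powr (- real CARD('d) / 2) = (1 / sqrt (2 * pi)) ^ CARD('d)"
      by (simp add: powr_minus_divide powr_half_sqrt[symmetric] power_one_over powr_powr
          powr_realpow[symmetric])
    moreover have "exp (- (norm x)\<^sup>2 / 2) = (\<Prod>j\<in>UNIV. exp (- (x $ j)\<^sup>2 / 2))"
      by (simp add: exp_sum[symmetric] norm_power2_vec sum_divide_distrib sum_negf)
    ultimately show ?thesis
      by (simp only: v_infty_def std_normal_density_def prod.distrib prod_constant)
  qed
  show ?thesis
    using has_bochner_integral_prod_coord[of "\<lambda>j x. std_normal_density x * hermite (k j) x", OF integrable_std_normal_hermite]
    by (subst has_bochner_integral_gauss) (simp_all add: v multi_hermite_def prod.distrib)
qed

lemma integrable_multi_hermite: "integrable gauss_measure (multi_hermite k)"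
  using multi_hermite_gauss by (rule integrable.intros)

text \<open>One of the factors has positive degree and integrates to zero. This makes the constant 1
  in \<open>w - 1\<close> orthogonal to nonconstant Hermite polynomials.\<close>

lemma integral_multi_hermite:
  assumes "0 < (\<Sum>j\<in>UNIV. k j)"
  shows "(\<integral>x. multi_hermite k x \<partial>gauss_measure) = 0"
proof -
  obtain j where "0 < k j" using assms by (metis gr0I sum.neutral less_irrefl)
  then show ?thesis
    using has_bochner_integral_integral_eq[OF multi_hermite_gauss[of k]] integral_std_normal_hermite[of "k j"]
    by (auto intro!: prod_zero bexI[of _ j])
qed

text \<open>Linear combinations are built one term at a time, so that orthogonality follows by
  induction without handling coefficient families.\<close>

inductive hermite_span :: "nat \<Rightarrow> (real ^ 'd \<Rightarrow> real) \<Rightarrow> bool" for n where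
  zero: "hermite_span n (\<lambda>x. 0)"
| add: "(\<Sum>j\<in>UNIV. k j) \<le> n \<Longrightarrow> hermite_span n f \<Longrightarrow> hermite_span n (\<lambda>x. c * multi_hermite k x + f x)"

lemma hermite_span_plus:
  "hermite_span n f \<Longrightarrow> hermite_span n g \<Longrightarrow> hermite_span n (\<lambda>x. f x + g x)"
  by (induction rule: hermite_span.induct) (auto simp: add.assoc intro: hermite_span.add)

lemma hermite_span_basis: "(\<Sum>j\<in>UNIV. k j) \<le> n \<Longrightarrow> hermite_span n (\<lambda>x. c * multi_hermite k x)"
  using hermite_span.add[OF _ hermite_span.zero, of k n c] by simp

lemma hermite_span_cmult: "hermite_span n f \<Longrightarrow> hermite_span n (\<lambda>x. c * f x)"
proof (induction rule: hermite_span.induct)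
  case (add k f d)
  then show ?case using hermite_span.add[of k n "\<lambda>x. c * f x" "c * d"] by (simp add: distrib_left mult.assoc)
qed (simp add: hermite_span.zero)

lemma hermite_span_sum:
  "finite A \<Longrightarrow> (\<And>i. i \<in> A \<Longrightarrow> hermite_span n (f i)) \<Longrightarrow> hermite_span n (\<lambda>x. \<Sum>i\<in>A. f i x)"
  by (induction A rule: finite_induct) (auto intro: hermite_span.zero hermite_span_plus)

text \<open>The recurrence in coordinate \<open>j\<close> replaces \<open>k j\<close> by its
  successor and its truncated predecessor, raising the total degree by at most one.\<close>

lemma hermite_span_coord: "hermite_span n f \<Longrightarrow> hermite_span (Suc n) (\<lambda>x. x $ j * f x)"
proof (induction rule: hermite_span.induct)
  case (add k f c)
  obtain a b where ab: "\<And>y. y * hermite (k j) y = a * hermite (Suc (k j)) y + b * hermite (k j - 1) y"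
    using hermite_recurrence[of "k j"] by blast
  have upd: "multi_hermite (k(j := m)) x = hermite m (x $ j) * (\<Prod>i\<in>UNIV - {j}. hermite (k i) (x $ i))" for m x
    unfolding multi_hermite_def by (subst prod.remove[of _ j]) (auto intro!: prod.cong)
  have "x $ j * multi_hermite k x = a * multi_hermite (k(j := Suc (k j))) x + b * multi_hermite (k(j := k j - 1)) x" for x
  proof -
    have "x $ j * multi_hermite k x = (x $ j * hermite (k j) (x $ j)) * (\<Prod>i\<in>UNIV - {j}. hermite (k i) (x $ i))"
      using upd[of "k j" x] by simp
    then show ?thesis by (simp add: ab upd distrib_right)
  qed
  then have eq: "(\<lambda>x. x $ j * (c * multi_hermite k x + f x)) = (\<lambda>x.
      (c * a) * multi_hermite (k(j := Suc (k j))) x + ((c * b) * multi_hermite (k(j := k j - 1)) x + x $ j * f x))"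
    by (simp add: fun_eq_iff distrib_left mult.left_commute[of _ c] mult.assoc)
  have s: "(\<Sum>i\<in>UNIV. (k(j := m)) i) = m + (\<Sum>i\<in>UNIV - {j}. k i)" for m
    by (subst sum.remove[of _ j]) (auto intro!: sum.cong)
  have "(\<Sum>i\<in>UNIV. k i) = k j + (\<Sum>i\<in>UNIV - {j}. k i)" using s[of "k j"] by simp
  then have "(\<Sum>i\<in>UNIV. (k(j := Suc (k j))) i) \<le> Suc n" "(\<Sum>i\<in>UNIV. (k(j := k j - 1)) i) \<le> Suc n"
    using add.hyps unfolding s by auto
  then show ?case unfolding eq by (intro hermite_span.add add.IH)
qed (simp add: hermite_span.zero)

text \<open>Both the inner product and the squared norm are sums over coordinates, so each factor is
  produced by multiplying with one or two coordinates.\<close>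

lemma hermite_span_monomial:
  "hermite_span (i + 2 * j) (\<lambda>y :: real ^ 'd. (x \<bullet> y) ^ i * ((norm y)\<^sup>2) ^ j)"
proof -
  have *: "hermite_span (2 * j) (\<lambda>y :: real ^ 'd. ((norm y)\<^sup>2) ^ j)"
  proof (induction j)
    case 0 then show ?case using hermite_span_basis[of "\<lambda>_. 0" 0 1] by simp
  next
    case (Suc j)
    have "hermite_span (Suc (Suc (2 * j))) (\<lambda>y :: real ^ 'd. \<Sum>l\<in>UNIV. y $ l * (y $ l * ((norm y)\<^sup>2) ^ j))"
      by (intro hermite_span_sum hermite_span_coord Suc) simp
    moreover have "(\<Sum>l\<in>UNIV. y $ l * (y $ l * ((norm y)\<^sup>2) ^ j)) = ((norm y)\<^sup>2) ^ Suc j" for y :: "real ^ 'd"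
    proof -
      have "(\<Sum>l\<in>UNIV. y $ l * y $ l) = (norm y)\<^sup>2" unfolding norm_power2_vec by (simp add: power2_eq_square)
      then show ?thesis by (simp only: mult.assoc[symmetric] sum_distrib_right[symmetric] power_Suc)
    qed
    ultimately show ?case by simp
  qed
  show ?thesis
  proof (induction i)
    case 0 then show ?case using * by simp
  next
    case (Suc i)
    have "hermite_span (Suc (i + 2 * j)) (\<lambda>y. \<Sum>l\<in>UNIV. x $ l * (y $ l * ((x \<bullet> y) ^ i * ((norm y)\<^sup>2) ^ j)))"
      by (intro hermite_span_sum hermite_span_cmult hermite_span_coord Suc) simp
    moreover have "(\<Sum>l\<in>UNIV. x $ l * (y $ l * ((x \<bullet> y) ^ i * ((norm y)\<^sup>2) ^ j))) = (x \<bullet> y) ^ Suc i * ((norm y)\<^sup>2) ^ j" for y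
      by (simp add: inner_vec_real[of x y] sum_distrib_right mult.assoc)
    ultimately show ?case by simp
  qed
qed

lemma integrable_mult_multi_hermite:
  assumes "bounded_meas gauss_measure g"
  shows "integrable gauss_measure (\<lambda>x. g x * multi_hermite k x)"
proof -
  obtain B where B: "0 \<le> B" "\<And>x. \<bar>g x\<bar> \<le> B" using assms by (metis bounded_measE)
  have [measurable]: "g \<in> borel_measurable borel" using assms by (auto dest: bounded_meas_measurable)
  show ?thesis
  proof (rule Bochner_Integration.integrable_bound)
    show "integrable gauss_measure (\<lambda>x. B * multi_hermite k x)" by (simp add: integrable_multi_hermite)
    show "AE x in gauss_measure. norm (g x * multi_hermite k x) \<le> norm (B * multi_hermite k x)"
      using B by (intro AE_I2) (auto simp: abs_mult intro!: mult_right_mono)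
  qed simp
qed

text \<open>Integrability belongs to the conclusion because the induction splits the integral of a
  sum.\<close>

lemma hermite_span_orthogonal:
  assumes f: "hermite_span m f" "m < n" and g: "bounded_meas gauss_measure g"
    and orth: "\<And>k. (\<Sum>j\<in>UNIV. k j) < n \<Longrightarrow> (\<integral>x. g x * multi_hermite k x \<partial>gauss_measure) = 0"
  shows "integrable gauss_measure (\<lambda>x. g x * f x) \<and> (\<integral>x. g x * f x \<partial>gauss_measure) = 0"
  using f(1)
proof (induction rule: hermite_span.induct)
  case (add k f c)
  have "(\<lambda>x. g x * (c * multi_hermite k x + f x)) = (\<lambda>x. c * (g x * multi_hermite k x) + g x * f x)"
    by (simp add: fun_eq_iff algebra_simps)
  then show ?case using integrable_mult_multi_hermite[OF g, of k] add orth[of k] f(2) by simp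
qed simp

section \<open>The spectral gap on functions orthogonal to low-degree Hermite polynomials\<close>

text \<open>Write \<open>\<bar>x\<bar> = l * y\<close>. Every term of order at least
  \<open>m\<close> yields a factor \<open>l ^ m\<close>, as \<open>l \<le> 1\<close>, and the
  remaining series is at most \<open>exp y\<close>.\<close>

lemma exp_remainder_bound:
  fixes x l :: real
  assumes l: "0 < l" "l \<le> 1"
  shows "\<bar>exp x - (\<Sum>i<m. x ^ i / fact i)\<bar> \<le> l ^ m * exp (\<bar>x\<bar> / l)"
proof -
  define y where "y = \<bar>x\<bar> / l"
  have y: "0 \<le> y" "\<bar>x\<bar> = l * y" using l by (auto simp: y_def)
  have sy: "summable (\<lambda>i. y ^ (i + m) / fact (i + m))"
    using summable_ignore_initial_segment[OF summable_exp[of y], of m] by (simp add: divide_inverse mult.commute)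
  have eqx: "exp z = (\<Sum>i<m. z ^ i / fact i) + (\<Sum>i. z ^ (i + m) / fact (i + m))" for z :: real
    using exp_first_terms[of z m] by (simp add: divide_inverse mult.commute)
  have le: "norm (x ^ (i + m) / fact (i + m)) \<le> l ^ m * (y ^ (i + m) / fact (i + m))" for i
  proof -
    have "\<bar>x\<bar> ^ (i + m) = l ^ m * (l ^ i * y ^ (i + m))"
      unfolding y(2) by (simp add: power_mult_distrib power_add)
    also have "\<dots> \<le> l ^ m * (1 * y ^ (i + m))"
      using l y by (intro mult_left_mono mult_right_mono power_le_one) auto
    finally show ?thesis by (simp add: power_abs divide_right_mono)
  qed
  have "\<bar>exp x - (\<Sum>i<m. x ^ i / fact i)\<bar> = norm (\<Sum>i. x ^ (i + m) / fact (i + m))"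
    by (simp add: eqx[of x])
  also have "\<dots> \<le> (\<Sum>i. l ^ m * (y ^ (i + m) / fact (i + m)))"
    by (rule norm_suminf_le[OF le summable_mult[OF sy]])
  also have "\<dots> = l ^ m * (\<Sum>i. y ^ (i + m) / fact (i + m))" by (rule suminf_mult[OF sy])
  also have "\<dots> \<le> l ^ m * exp y"
    using l y by (intro mult_left_mono) (auto simp: eqx[of y] intro!: sum_nonneg)
  finally show ?thesis by (simp add: y_def)
qed

lemma exp_sum_le: "0 \<le> (x :: real) \<Longrightarrow> (\<Sum>i<m. x ^ i / fact i) \<le> exp x"
  using exp_first_terms[of x m] summable_ignore_initial_segment[OF summable_exp[of x], of m]
  by (simp add: divide_inverse mult.commute suminf_nonneg)

text \<open>Here \<open>a\<close> counts with weight one and \<open>b\<close> with weight two, so that all terms of weighted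
  degree less than \<open>n\<close> in the double Taylor expansion of \<open>exp a * exp b\<close> are removed.\<close>

lemma exp_weighted_remainder_bound:
  fixes a b l :: real
  assumes l: "0 < l" "l \<le> 1"
  shows "\<bar>exp (a + b) - (\<Sum>j<n. \<Sum>i<n - 2 * j. a ^ i / fact i * (b ^ j / fact j))\<bar>
    \<le> 2 * l ^ n * exp (\<bar>a\<bar> / l + \<bar>b\<bar> / l\<^sup>2)"
proof -
  \<comment> \<open>The least \<open>m\<close> with \<open>n \<le> 2 * m\<close>: from there on the
    inner sums are empty.\<close>
  define m where "m = (n + 1) div 2"
  have m: "m \<le> n" "n \<le> 2 * m" "\<And>j. m \<le> j \<Longrightarrow> n - 2 * j = 0" "\<And>j. j < m \<Longrightarrow> 2 * j \<le> n"
    unfolding m_def by auto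
  have l2: "0 < l\<^sup>2" "l\<^sup>2 \<le> 1" using l by (auto simp: power_le_one)
  have "(\<Sum>j<n. \<Sum>i<n - 2 * j. a ^ i / fact i * (b ^ j / fact j)) =
      (\<Sum>j<m. \<Sum>i<n - 2 * j. a ^ i / fact i * (b ^ j / fact j))"
    by (rule sum.mono_neutral_right) (use m in auto)
  also have "\<dots> = (\<Sum>j<m. (b ^ j / fact j) * (\<Sum>i<n - 2 * j. a ^ i / fact i))"
    by (simp only: sum_distrib_left mult.commute)
  \<comment> \<open>First the remainder in \<open>b\<close> beyond order \<open>m\<close>, then for
    each retained power of \<open>b\<close> the remainder in \<open>a\<close> beyond order
    \<open>n - 2 * j\<close>.\<close>
  finally have eq: "exp (a + b) - (\<Sum>j<n. \<Sum>i<n - 2 * j. a ^ i / fact i * (b ^ j / fact j)) =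
      (exp b - (\<Sum>j<m. b ^ j / fact j)) * exp a +
      (\<Sum>j<m. (b ^ j / fact j) * (exp a - (\<Sum>i<n - 2 * j. a ^ i / fact i)))"
    by (simp add: exp_add left_diff_distrib right_diff_distrib sum_subtractf sum_distrib_right)
  have 1: "\<bar>(exp b - (\<Sum>j<m. b ^ j / fact j)) * exp a\<bar> \<le> l ^ n * exp (\<bar>a\<bar> / l + \<bar>b\<bar> / l\<^sup>2)"
  proof -
    have "\<bar>(exp b - (\<Sum>j<m. b ^ j / fact j))\<bar> * exp a \<le> ((l\<^sup>2) ^ m * exp (\<bar>b\<bar> / l\<^sup>2)) * exp (\<bar>a\<bar> / l)"
    proof (rule mult_mono)
      have "a \<le> \<bar>a\<bar> / l"
        by (rule order_trans[OF abs_ge_self]) (use l in \<open>simp add: le_divide_eq mult_left_le\<close>)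
      then show "exp a \<le> exp (\<bar>a\<bar> / l)" by simp
    qed (use exp_remainder_bound[OF l2, of b m] in auto)
    also have "\<dots> = l ^ (2 * m) * exp (\<bar>a\<bar> / l + \<bar>b\<bar> / l\<^sup>2)" by (simp add: exp_add power_mult)
    also have "\<dots> \<le> l ^ n * exp (\<bar>a\<bar> / l + \<bar>b\<bar> / l\<^sup>2)"
      using l m by (intro mult_right_mono power_decreasing) auto
    finally show ?thesis by (simp add: abs_mult)
  qed
  have 2: "\<bar>\<Sum>j<m. (b ^ j / fact j) * (exp a - (\<Sum>i<n - 2 * j. a ^ i / fact i))\<bar> \<le> l ^ n * exp (\<bar>a\<bar> / l + \<bar>b\<bar> / l\<^sup>2)"
  proof -
    have "\<bar>\<Sum>j<m. (b ^ j / fact j) * (exp a - (\<Sum>i<n - 2 * j. a ^ i / fact i))\<bar> \<le>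
        (\<Sum>j<m. \<bar>(b ^ j / fact j) * (exp a - (\<Sum>i<n - 2 * j. a ^ i / fact i))\<bar>)" by (rule sum_abs)
    also have "\<dots> \<le> (\<Sum>j<m. l ^ n * exp (\<bar>a\<bar> / l) * ((\<bar>b\<bar> / l\<^sup>2) ^ j / fact j))"
    proof (rule sum_mono)
      fix j assume j: "j \<in> {..<m}"
      have "\<bar>(b ^ j / fact j) * (exp a - (\<Sum>i<n - 2 * j. a ^ i / fact i))\<bar> \<le>
          \<bar>b\<bar> ^ j / fact j * (l ^ (n - 2 * j) * exp (\<bar>a\<bar> / l))"
        unfolding abs_mult using exp_remainder_bound[OF l, of a "n - 2 * j"]
        by (intro mult_mono) (auto simp: power_abs)
      \<comment> \<open>The missing power of \<open>l\<close> is absorbed by pairing each factor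
        \<open>\<bar>b\<bar>\<close> with \<open>l\<^sup>2\<close>.\<close>
      also have "l ^ (n - 2 * j) = l ^ n / (l\<^sup>2) ^ j"
        using l m(4)[of j] j by (simp add: power_diff power_mult)
      finally show "\<bar>(b ^ j / fact j) * (exp a - (\<Sum>i<n - 2 * j. a ^ i / fact i))\<bar> \<le>
          l ^ n * exp (\<bar>a\<bar> / l) * ((\<bar>b\<bar> / l\<^sup>2) ^ j / fact j)"
        by (simp add: power_divide mult_ac)
    qed
    also have "\<dots> = l ^ n * exp (\<bar>a\<bar> / l) * (\<Sum>j<m. (\<bar>b\<bar> / l\<^sup>2) ^ j / fact j)" by (simp only: sum_distrib_left)
    also have "\<dots> \<le> l ^ n * exp (\<bar>a\<bar> / l) * exp (\<bar>b\<bar> / l\<^sup>2)"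
      using l by (intro mult_left_mono exp_sum_le) auto
    finally show ?thesis by (simp add: exp_add mult.assoc)
  qed
  have "\<bar>exp (a + b) - (\<Sum>j<n. \<Sum>i<n - 2 * j. a ^ i / fact i * (b ^ j / fact j))\<bar> \<le>
      l ^ n * exp (\<bar>a\<bar> / l + \<bar>b\<bar> / l\<^sup>2) + l ^ n * exp (\<bar>a\<bar> / l + \<bar>b\<bar> / l\<^sup>2)"
    unfolding eq by (rule order_trans[OF abs_triangle_ineq add_mono[OF 1 2]])
  then show ?thesis by simp
qed

section \<open>Decay of the Ornstein--Uhlenbeck operators\<close>

abbreviation OU :: "real \<Rightarrow> (real ^ 'd \<Rightarrow> real) \<Rightarrow> real ^ 'd \<Rightarrow> real" where
  "OU \<rho> \<equiv> kernel_op gauss_measure (mehler \<rho>)"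

text \<open>The zero multi-index is included for \<open>n > 0\<close>, so mean zero is then part of
  the condition; it is meant for \<open>w - 1\<close>.\<close>

definition hermite_orthogonal :: "nat \<Rightarrow> (real ^ 'd \<Rightarrow> real) \<Rightarrow> bool" where
  "hermite_orthogonal n g \<longleftrightarrow>
     (\<forall>k. (\<Sum>j\<in>UNIV. k j) < n \<longrightarrow> (\<integral>x. g x * multi_hermite k x \<partial>gauss_measure) = 0)"

text \<open>The kernel is \<open>c * exp (a y + b y)\<close> with \<open>a\<close> linear in
  \<open>y\<close> of order \<rho> and \<open>b\<close> quadratic of order
  \<open>\<rho>\<^sup>2\<close>. Orthogonality removes the Taylor terms of weighted degree less than
  \<open>n\<close>, and the remainder is of order \<open>\<rho> ^ n\<close>.\<close>

lemma OU_pointwise_decay: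
  fixes g :: "real ^ 'd \<Rightarrow> real"
  assumes g: "bounded_meas gauss_measure g" and orth: "hermite_orthogonal n g"
  obtains C where "0 \<le> C"
    and "\<And>\<rho> x. 0 < \<rho> \<Longrightarrow> \<rho> \<le> 1 / 8 \<Longrightarrow> \<bar>OU \<rho> g x\<bar> \<le> C * \<rho> ^ n * exp ((norm x)\<^sup>2 / 8)"
proof -
  obtain B where B: "0 \<le> B" "\<And>x. \<bar>g x\<bar> \<le> B" using g by (metis bounded_measE)
  have [measurable]: "g \<in> borel_measurable borel" using g by (auto dest: bounded_meas_measurable)
  define I where "I = (\<integral>y. exp ((norm (y :: real ^ 'd))\<^sup>2 / 4) \<partial>gauss_measure)"
  have iI: "integrable gauss_measure (\<lambda>y :: real ^ 'd. exp ((norm y)\<^sup>2 / 4))"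
    using gauss_exp_quadratic[of "- 1 / 2" "0 :: real ^ 'd"] by (simp add: has_bochner_integral_iff)
  have I: "0 \<le> I" unfolding I_def by simp
  define C where "C = 2 powr (real CARD('d) / 2) * (B * 2 * 8 ^ n * I)"
  show ?thesis
  proof (rule that[of C])
    show "0 \<le> C" unfolding C_def using B I by simp
    fix \<rho> :: real and x :: "real ^ 'd"
    assume \<rho>: "0 < \<rho>" "\<rho> \<le> 1 / 8"
    define r where "r = 1 - \<rho>\<^sup>2"
    have "\<rho>\<^sup>2 \<le> (1 / 8)\<^sup>2" using \<rho> by (intro power_mono) auto
    then have r: "1 / 2 \<le> r" "r \<le> 1" by (auto simp: r_def power2_eq_square)
    \<comment> \<open>The factor 8 keeps the majorant \<open>exp ((norm y)\<^sup>2 / 4)\<close>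
      integrable, and likewise the square of \<open>exp ((norm x)\<^sup>2 / 8)\<close>;
      \<open>\<rho> \<le> 1 / 8\<close> ensures \<open>l \<le> 1\<close>.\<close>
    define l where "l = 8 * \<rho>"
    have l: "0 < l" "l \<le> 1" using \<rho> by (auto simp: l_def)
    define a b where "a y = \<rho> / r * (x \<bullet> y)" and "b y = - (\<rho>\<^sup>2 / r) * (norm y)\<^sup>2 / 2" for y :: "real ^ 'd"
    define P where "P y = (\<Sum>j<n. \<Sum>i<n - 2 * j. a y ^ i / fact i * (b y ^ j / fact j))" for y
    define c where "c = r powr (- real CARD('d) / 2) * exp (- \<rho>\<^sup>2 * (norm x)\<^sup>2 / (2 * r))"
    have Kc: "mehler \<rho> x y = c * exp (a y + b y)" for y
      unfolding mehler_eq c_def r_def a_def b_def by (simp add: add.commute)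
    have c: "0 \<le> c" "c \<le> 2 powr (real CARD('d) / 2)"
    proof -
      have "r powr (- real CARD('d) / 2) = (1 / r) powr (real CARD('d) / 2)"
        using r by (simp add: powr_minus_divide powr_divide)
      also have "\<dots> \<le> 2 powr (real CARD('d) / 2)"
        using r by (intro powr_mono2) (auto simp: field_simps)
      finally have "r powr (- real CARD('d) / 2) * exp (- \<rho>\<^sup>2 * (norm x)\<^sup>2 / (2 * r)) \<le> 2 powr (real CARD('d) / 2) * 1"
        using r by (intro mult_mono) (auto simp: divide_nonneg_nonneg)
      then show "c \<le> 2 powr (real CARD('d) / 2)" by (simp add: c_def)
      show "0 \<le> c" by (simp add: c_def)
    qed
    \<comment> \<open>Each term of \<open>P\<close> is a multiple of a monomial of degree
      \<open>i + 2 * j < n\<close> in \<open>y\<close>, to which \<open>g\<close> is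
      orthogonal.\<close>
    have gP: "integrable gauss_measure (\<lambda>y. g y * P y) \<and> (\<integral>y. g y * P y \<partial>gauss_measure) = 0"
    proof -
      have monomial: "integrable gauss_measure (\<lambda>y. g y * (a y ^ i / fact i * (b y ^ j / fact j))) \<and>
          (\<integral>y. g y * (a y ^ i / fact i * (b y ^ j / fact j)) \<partial>gauss_measure) = 0" if "i < n - 2 * j" for i j
      proof -
        define d where "d = (\<rho> / r) ^ i / fact i * ((- (\<rho>\<^sup>2 / r) / 2) ^ j / fact j)"
        have "g y * (a y ^ i / fact i * (b y ^ j / fact j)) = d * (g y * ((x \<bullet> y) ^ i * ((norm y)\<^sup>2) ^ j))" for y
        proof -
          have "b y ^ j = (- (\<rho>\<^sup>2 / r) / 2) ^ j * ((norm y)\<^sup>2) ^ j"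
            unfolding b_def power_mult_distrib[symmetric] by (simp add: mult.commute)
          then show ?thesis unfolding a_def d_def power_mult_distrib by simp
        qed
        then show ?thesis
          using hermite_span_orthogonal[OF hermite_span_monomial[of i j x] _ g, of n] orth that
          by (simp add: hermite_orthogonal_def)
      qed
      have "g y * P y = (\<Sum>j<n. \<Sum>i<n - 2 * j. g y * (a y ^ i / fact i * (b y ^ j / fact j)))" for y
        unfolding P_def by (simp add: sum_distrib_left)
      then have eq: "(\<lambda>y. g y * P y) = (\<lambda>y. \<Sum>j<n. \<Sum>i<n - 2 * j. g y * (a y ^ i / fact i * (b y ^ j / fact j)))"
        by (rule ext)
      have int: "integrable gauss_measure (\<lambda>y. \<Sum>i<n - 2 * j. g y * (a y ^ i / fact i * (b y ^ j / fact j)))" for j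
        using monomial by (intro Bochner_Integration.integrable_sum) blast
      have "(\<integral>y. (\<Sum>i<n - 2 * j. g y * (a y ^ i / fact i * (b y ^ j / fact j))) \<partial>gauss_measure) = 0" for j
        using monomial by (subst Bochner_Integration.integral_sum) (blast, intro sum.neutral, blast)
      then show ?thesis unfolding eq using int
        by (simp only: Bochner_Integration.integrable_sum Bochner_Integration.integral_sum sum.neutral_const simp_thms)
    qed
    have rem: "\<bar>g y * (exp (a y + b y) - P y)\<bar> \<le> B * 2 * l ^ n * exp ((norm x)\<^sup>2 / 8) * exp ((norm y)\<^sup>2 / 4)" for y
    proof -
      have a: "\<bar>a y\<bar> / l \<le> (norm x)\<^sup>2 / 8 + (norm y)\<^sup>2 / 8"
      proof -
        have "\<bar>a y\<bar> / l = \<bar>x \<bullet> y\<bar> / (8 * r)" using \<rho> r by (simp add: a_def l_def abs_mult)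
        also have "\<dots> \<le> (norm x * norm y) / 4"
          using r by (intro frac_le Cauchy_Schwarz_ineq2) auto
        also have "\<dots> \<le> (norm x)\<^sup>2 / 8 + (norm y)\<^sup>2 / 8"
          using sum_squares_bound[of "norm x" "norm y"] by simp
        finally show ?thesis .
      qed
      have b: "\<bar>b y\<bar> / l\<^sup>2 \<le> (norm y)\<^sup>2 / 8"
      proof -
        have "\<bar>b y\<bar> / l\<^sup>2 = (norm y)\<^sup>2 / (128 * r)"
          using \<rho> r by (simp add: b_def l_def abs_mult power_mult_distrib)
        also have "\<dots> \<le> (norm y)\<^sup>2 / 8" using r by (intro frac_le) auto
        finally show ?thesis .
      qed
      have "\<bar>g y * (exp (a y + b y) - P y)\<bar> \<le> B * (2 * l ^ n * exp (\<bar>a y\<bar> / l + \<bar>b y\<bar> / l\<^sup>2))"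
        unfolding abs_mult P_def using B by (intro mult_mono exp_weighted_remainder_bound l) auto
      also have "\<dots> \<le> B * (2 * l ^ n * exp ((norm x)\<^sup>2 / 8 + (norm y)\<^sup>2 / 4))"
      proof -
        have "\<bar>a y\<bar> / l + \<bar>b y\<bar> / l\<^sup>2 \<le> (norm x)\<^sup>2 / 8 + (norm y)\<^sup>2 / 4" using a b by linarith
        then show ?thesis using B l by (intro mult_left_mono) auto
      qed
      finally show ?thesis by (simp add: exp_add mult_ac)
    qed
    have [measurable]: "P \<in> borel_measurable borel" unfolding P_def a_def b_def by measurable
    have mab: "(\<lambda>y. exp (a y + b y)) \<in> borel_measurable borel" unfolding a_def b_def by measurable
    have irem: "integrable gauss_measure (\<lambda>y. g y * (exp (a y + b y) - P y))"
    proof (rule Bochner_Integration.integrable_bound)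
      show "integrable gauss_measure (\<lambda>y :: real ^ 'd. B * 2 * l ^ n * exp ((norm x)\<^sup>2 / 8) * exp ((norm y)\<^sup>2 / 4))"
        using iI by simp
      show "(\<lambda>y. g y * (exp (a y + b y) - P y)) \<in> borel_measurable gauss_measure" using mab by simp
    qed (use rem B l in \<open>auto intro!: AE_I2\<close>)
    have "OU \<rho> g x = (\<integral>y. c * (g y * (exp (a y + b y) - P y) + g y * P y) \<partial>gauss_measure)"
      unfolding kernel_op_def Kc by (simp add: algebra_simps)
    also have "\<dots> = c * (\<integral>y. g y * (exp (a y + b y) - P y) \<partial>gauss_measure)"
      using irem gP by simp
    finally have "\<bar>OU \<rho> g x\<bar> = c * \<bar>\<integral>y. g y * (exp (a y + b y) - P y) \<partial>gauss_measure\<bar>"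
      using c by (simp add: abs_mult)
    also have "\<dots> \<le> 2 powr (real CARD('d) / 2) * (B * 2 * l ^ n * exp ((norm x)\<^sup>2 / 8) * I)"
    proof (rule mult_mono)
      have "\<bar>\<integral>y. g y * (exp (a y + b y) - P y) \<partial>gauss_measure\<bar> \<le>
          (\<integral>y. \<bar>g y * (exp (a y + b y) - P y)\<bar> \<partial>gauss_measure)" by (rule integral_abs_bound)
      also have "\<dots> \<le> (\<integral>y. B * 2 * l ^ n * exp ((norm x)\<^sup>2 / 8) * exp ((norm (y :: real ^ 'd))\<^sup>2 / 4) \<partial>gauss_measure)"
        by (rule Bochner_Integration.integral_mono) (use irem iI rem in auto)
      finally show "\<bar>\<integral>y. g y * (exp (a y + b y) - P y) \<partial>gauss_measure\<bar> \<le> B * 2 * l ^ n * exp ((norm x)\<^sup>2 / 8) * I"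
        by (simp add: I_def)
    qed (use c in auto)
    also have "\<dots> = C * \<rho> ^ n * exp ((norm x)\<^sup>2 / 8)"
      by (simp add: C_def l_def power_mult_distrib)
    finally show "\<bar>OU \<rho> g x\<bar> \<le> C * \<rho> ^ n * exp ((norm x)\<^sup>2 / 8)" .
  qed
qed

lemma bounded_meas_OU: "0 < \<rho> \<Longrightarrow> \<rho> < 1 \<Longrightarrow> bounded_meas gauss_measure g \<Longrightarrow> bounded_meas gauss_measure (OU \<rho> g)"
  using symmetric_markov.bounded_meas_op[OF symmetric_markov_mehler] .

lemma OU_L2_decay:
  fixes g :: "real ^ 'd \<Rightarrow> real"
  assumes g: "bounded_meas gauss_measure g" and orth: "hermite_orthogonal n g"
  obtains C where "\<And>\<rho>. 0 < \<rho> \<Longrightarrow> \<rho> \<le> 1 / 8 \<Longrightarrow> (\<integral>x. (OU \<rho> g x)\<^sup>2 \<partial>gauss_measure) \<le> C * \<rho> ^ (2 * n)"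
proof -
  obtain C where C: "0 \<le> C"
    "\<And>\<rho> x. 0 < \<rho> \<Longrightarrow> \<rho> \<le> 1 / 8 \<Longrightarrow> \<bar>OU \<rho> g x\<bar> \<le> C * \<rho> ^ n * exp ((norm x)\<^sup>2 / 8)"
    using OU_pointwise_decay[OF g orth] by blast
  have iI: "integrable gauss_measure (\<lambda>y :: real ^ 'd. exp ((norm y)\<^sup>2 / 4))"
    using gauss_exp_quadratic[of "- 1 / 2" "0 :: real ^ 'd"] by (simp add: has_bochner_integral_iff)
  show ?thesis
  proof (rule that)
    fix \<rho> :: real assume \<rho>: "0 < \<rho>" "\<rho> \<le> 1 / 8"
    have le: "(OU \<rho> g x)\<^sup>2 \<le> C\<^sup>2 * \<rho> ^ (2 * n) * exp ((norm x)\<^sup>2 / 4)" for x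
    proof -
      have "\<bar>OU \<rho> g x\<bar>\<^sup>2 \<le> (C * \<rho> ^ n * exp ((norm x)\<^sup>2 / 8))\<^sup>2"
        by (intro power_mono C \<rho>) auto
      moreover have "(exp ((norm x)\<^sup>2 / 8))\<^sup>2 = exp ((norm x)\<^sup>2 / 4)"
        by (simp add: power2_eq_square exp_add[symmetric])
      ultimately show ?thesis by (simp add: power_mult_distrib power_mult[symmetric] mult.commute)
    qed
    have "bounded_meas gauss_measure (OU \<rho> g)" using \<rho> g by (intro bounded_meas_OU) auto
    then have "integrable gauss_measure (\<lambda>x. (OU \<rho> g x)\<^sup>2)"
      by (intro gauss.bounded_meas_integrable bounded_meas_power2)
    then have "(\<integral>x. (OU \<rho> g x)\<^sup>2 \<partial>gauss_measure) \<le> (\<integral>x. C\<^sup>2 * \<rho> ^ (2 * n) * exp ((norm (x :: real ^ 'd))\<^sup>2 / 4) \<partial>gauss_measure)"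
      by (rule Bochner_Integration.integral_mono) (use iI le in auto)
    then show "(\<integral>x. (OU \<rho> g x)\<^sup>2 \<partial>gauss_measure) \<le> (C\<^sup>2 * (\<integral>y. exp ((norm (y :: real ^ 'd))\<^sup>2 / 4) \<partial>gauss_measure)) * \<rho> ^ (2 * n)"
      by (simp add: mult_ac)
  qed
qed

lemma OU_compose:
  assumes "0 < \<rho>" "\<rho> < 1" "0 < \<sigma>" "\<sigma> < 1" "bounded_meas gauss_measure f"
  shows "OU \<rho> (OU \<sigma> f) = OU (\<rho> * \<sigma>) f"
  using assms by (intro ext kernel_op_compose symmetric_markov_mehler mehler_semigroup) auto

text \<open>The zeroth iterate is left out, as it would correspond to the degenerate kernel
  parameter 1.\<close>

lemma OU_funpow:
  assumes "0 < \<rho>" "\<rho> < 1" "bounded_meas gauss_measure f"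
  shows "(OU \<rho> ^^ Suc m) f = OU (\<rho> ^ Suc m) f"
proof (induction m)
  case (Suc m)
  have "(OU \<rho> ^^ Suc (Suc m)) f = OU \<rho> (OU (\<rho> ^ Suc m) f)" using Suc by simp
  also have "\<dots> = OU (\<rho> * \<rho> ^ Suc m) f"
    using assms by (intro OU_compose power_Suc_less_one) auto
  finally show ?case by simp
qed simp

text \<open>Stated for all iterates: the ratios of a log-convex sequence increase, so the decay as \<open>m \<rightarrow> \<infinity>\<close>
  bounds each of them, and orthogonality need not be propagated along the semigroup.\<close>

lemma OU_spectral_gap:
  fixes g :: "real ^ 'd \<Rightarrow> real"
  assumes \<rho>: "0 < \<rho>" "\<rho> < 1" and g: "bounded_meas gauss_measure g" and orth: "hermite_orthogonal n g"
  shows "(\<integral>x. ((OU \<rho> ^^ Suc j) g x)\<^sup>2 \<partial>gauss_measure)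
    \<le> \<rho> ^ (2 * n) * (\<integral>x. ((OU \<rho> ^^ j) g x)\<^sup>2 \<partial>gauss_measure)"
proof -
  interpret T: symmetric_markov gauss_measure "mehler \<rho> :: real ^ 'd \<Rightarrow> _" by (rule symmetric_markov_mehler[OF \<rho>])
  obtain C where C: "\<And>\<rho>. 0 < \<rho> \<Longrightarrow> \<rho> \<le> 1 / 8 \<Longrightarrow> (\<integral>x. (OU \<rho> g x)\<^sup>2 \<partial>gauss_measure) \<le> C * \<rho> ^ (2 * n)"
    using OU_L2_decay[OF g orth] by blast
  \<comment> \<open>From \<open>m0\<close> on the powers of \<rho> lie in the range where the decay
    estimate holds.\<close>
  obtain m0 where m0: "\<rho> ^ m0 < 1 / 8" using real_arch_pow_inv[of "1 / 8" \<rho>] \<rho> by auto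
  have decay: "(\<integral>x. ((OU \<rho> ^^ m) g x)\<^sup>2 \<partial>gauss_measure) \<le> C * (\<rho> ^ (2 * n)) ^ m" if m: "Suc m0 \<le> m" for m
  proof -
    obtain i where i: "m = Suc i" using m by (cases m) auto
    have "\<rho> ^ m \<le> \<rho> ^ m0" using \<rho> m by (intro power_decreasing) auto
    then have "(\<integral>x. (OU (\<rho> ^ m) g x)\<^sup>2 \<partial>gauss_measure) \<le> C * (\<rho> ^ m) ^ (2 * n)"
      using \<rho> m0 by (intro C) (simp, linarith)
    then show ?thesis
      unfolding i OU_funpow[OF \<rho> g] by (simp only: power_mult[symmetric] mult.commute)
  qed
  have "(\<integral>x. (OU \<rho> ((OU \<rho> ^^ j) g) x)\<^sup>2 \<partial>gauss_measure)
      \<le> \<rho> ^ (2 * n) * (\<integral>x. ((OU \<rho> ^^ j) g x)\<^sup>2 \<partial>gauss_measure)"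
  proof (rule T.op_contraction[OF T.bounded_meas_op_funpow[OF g]])
    show "0 < \<rho> ^ (2 * n)" using \<rho> by simp
    fix m assume m: "Suc m0 \<le> m"
    have "(OU \<rho> ^^ m) ((OU \<rho> ^^ j) g) = (OU \<rho> ^^ (m + j)) g" by (simp add: funpow_add)
    then show "(\<integral>x. ((OU \<rho> ^^ m) ((OU \<rho> ^^ j) g) x)\<^sup>2 \<partial>gauss_measure)
        \<le> (C * (\<rho> ^ (2 * n)) ^ j) * (\<rho> ^ (2 * n)) ^ m"
      using decay[of "m + j"] m by (simp add: power_add mult_ac)
  qed
  then show ?thesis by simp
qed

section \<open>Entropy decay and the heat equation\<close>

lemma OU_funpow_affine:
  assumes \<rho>: "0 < \<rho>" "\<rho> < 1" and w: "bounded_meas gauss_measure w"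
    and b: "\<And>x. m \<le> w x" "\<And>x. w x \<le> B"
  shows "m \<le> (OU \<rho> ^^ j) w x" "(OU \<rho> ^^ j) w x \<le> B"
    "(OU \<rho> ^^ j) (\<lambda>x. w x - c) x = (OU \<rho> ^^ j) w x - c"
    "(\<integral>x. (OU \<rho> ^^ j) w x \<partial>gauss_measure) = (\<integral>x. w x \<partial>gauss_measure)"
proof -
  interpret T: symmetric_markov gauss_measure "mehler \<rho> :: real ^ 'd \<Rightarrow> _" by (rule symmetric_markov_mehler[OF \<rho>])
  note bw = T.bounded_meas_op_funpow[OF w]
  show "m \<le> (OU \<rho> ^^ j) w x" for x
    using b(1) by (induction j arbitrary: x) (auto intro: T.op_lower bw)
  show "(OU \<rho> ^^ j) w x \<le> B" for x
    using b(2) by (induction j arbitrary: x) (auto intro: T.op_upper bw)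
  have "(OU \<rho> ^^ j) (\<lambda>x. w x - c) = (\<lambda>x. (OU \<rho> ^^ j) w x - c)"
  proof (induction j)
    case (Suc j)
    have "T.op (\<lambda>x. (OU \<rho> ^^ j) w x - c) x = T.op ((OU \<rho> ^^ j) w) x - c" for x
      using T.op_diff[OF bw bounded_meas_const] by (simp add: T.op_const)
    then show ?case unfolding funpow.simps comp_def Suc by (rule ext)
  qed simp
  then show "(OU \<rho> ^^ j) (\<lambda>x. w x - c) x = (OU \<rho> ^^ j) w x - c" by simp
  show "(\<integral>x. (OU \<rho> ^^ j) w x \<partial>gauss_measure) = (\<integral>x. w x \<partial>gauss_measure)"
    by (induction j) (auto simp: T.integral_op bw)
qed

text \<open>The constants \<open>m\<close>, \<open>B\<close> and \<open>S\<close> serve for every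
  iterate, because Markov operators preserve pointwise bounds. Each step then loses the same
  fraction \<kappa> of the entropy, and \<open>1 - \<kappa> \<le> exp (- \<kappa>)\<close>.\<close>

lemma OU_entropy_decay_discrete:
  fixes w :: "real ^ 'd \<Rightarrow> real"
  assumes p: "1 \<le> p" "p \<le> 2" and \<rho>: "0 < \<rho>" "\<rho> < 1"
    and w: "bounded_meas gauss_measure w" "(\<integral>x. w x \<partial>gauss_measure) = 1"
    and m: "0 \<le> m" "\<And>x. m \<le> w x" and B: "\<And>x. w x \<le> B"
    and S: "p / 2 \<le> S" "phi p m \<le> S * (m - 1)\<^sup>2"
    and orth: "hermite_orthogonal n (\<lambda>x. w x - 1)"
  shows "(\<integral>x. phi p ((OU \<rho> ^^ j) w x) \<partial>gauss_measure)
    \<le> exp (- (real j * (p * B powr (p - 2) / (2 * S) * (1 - \<rho> ^ (2 * n))))) * (\<integral>x. phi p (w x) \<partial>gauss_measure)"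
proof (induction j)
  case (Suc j)
  interpret T: symmetric_markov gauss_measure "mehler \<rho> :: real ^ 'd \<Rightarrow> _" by (rule symmetric_markov_mehler[OF \<rho>])
  define v where "v = (OU \<rho> ^^ j) w"
  define c where "c = p * B powr (p - 2) / 2"
  define \<kappa> where "\<kappa> = c / S * (1 - \<rho> ^ (2 * n))"
  let ?E = "\<lambda>f. \<integral>x. phi p (f x) \<partial>gauss_measure"
  note aff = OU_funpow_affine[OF \<rho> w(1) m(2) B]
  have v: "bounded_meas gauss_measure v" "\<And>x. m \<le> v x" "\<And>x. v x \<le> B" "(\<integral>x. v x \<partial>gauss_measure) = 1"
    using T.bounded_meas_op_funpow[OF w(1)] aff w by (auto simp: v_def)
  have v0: "0 \<le> v x" for x using m(1) v(2)[of x] by simp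
  note bv = T.bounded_meas_op[OF v(1)]
  note bi = bounded_meas_intros v(1) bv
  have c: "0 \<le> c" using p by (simp add: c_def)
  have S0: "0 < S" using p S by simp
  have q: "\<rho> ^ (2 * n) \<le> 1" using \<rho> by (simp add: power_le_one)
  have E0: "0 \<le> ?E f" if "\<And>x. 0 \<le> f x" for f :: "real ^ 'd \<Rightarrow> real"
    by (simp add: phi_nonneg p that)
  \<comment> \<open>For mean one, subtracting 1 shifts both squared norms equally, so entropy loss
    and spectral gap are stated for the same difference.\<close>
  have sq: "(\<integral>x. (f x - 1)\<^sup>2 \<partial>gauss_measure) = (\<integral>x. (f x)\<^sup>2 \<partial>gauss_measure) - 1"
    if "bounded_meas gauss_measure f" "(\<integral>x. f x \<partial>gauss_measure) = 1" for f :: "real ^ 'd \<Rightarrow> real"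
  proof -
    have "(\<integral>x. (f x - 1)\<^sup>2 \<partial>gauss_measure) = (\<integral>x. ((f x)\<^sup>2 - 2 * f x) + 1 \<partial>gauss_measure)"
      by (simp add: power2_diff algebra_simps)
    also have "\<dots> = ((\<integral>x. (f x)\<^sup>2 \<partial>gauss_measure) - 2 * 1) + 1"
      using that gauss.bounded_meas_integrable[OF bounded_meas_power2[OF that(1)]] gauss.bounded_meas_integrable[OF that(1)]
      by (simp add: gauss.prob_space[simplified])
    finally show ?thesis by simp
  qed
  have gap: "(\<integral>x. (OU \<rho> v x - 1)\<^sup>2 \<partial>gauss_measure) \<le> \<rho> ^ (2 * n) * (\<integral>x. (v x - 1)\<^sup>2 \<partial>gauss_measure)"
  proof -
    have "bounded_meas gauss_measure (\<lambda>x. w x - 1)" by (intro bounded_meas_diff bounded_meas_const w)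
    from OU_spectral_gap[OF \<rho> this orth, of j]
    show ?thesis by (simp only: aff(3)) (simp add: v_def)
  qed
  have upper: "?E v \<le> S * (\<integral>x. (v x - 1)\<^sup>2 \<partial>gauss_measure)"
  proof -
    have "?E v \<le> (\<integral>x. S * (v x - 1)\<^sup>2 \<partial>gauss_measure)"
    proof (rule Bochner_Integration.integral_mono)
      show "phi p (v x) \<le> S * (v x - 1)\<^sup>2" for x
        by (rule phi_le_up[OF p m(1) v(2) S])
    qed (intro gauss.bounded_meas_integrable bi bounded_meas_phi p v0)+
    then show ?thesis by simp
  qed
  have "c * ((\<integral>x. (v x)\<^sup>2 \<partial>gauss_measure) - (\<integral>x. (OU \<rho> v x)\<^sup>2 \<partial>gauss_measure)) \<le> ?E v - ?E (OU \<rho> v)"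
    unfolding c_def by (rule T.entropy_step[OF p v(1) v0 v(3)])
  then have "?E (OU \<rho> v) \<le> ?E v - c * ((\<integral>x. (v x - 1)\<^sup>2 \<partial>gauss_measure) - (\<integral>x. (OU \<rho> v x - 1)\<^sup>2 \<partial>gauss_measure))"
    using sq[OF v(1,4)] sq[OF bv] T.integral_op[OF v(1)] v(4) by simp
  also have "\<dots> \<le> ?E v - c * ((1 - \<rho> ^ (2 * n)) * (\<integral>x. (v x - 1)\<^sup>2 \<partial>gauss_measure))"
    using mult_left_mono[OF gap c] by (simp add: algebra_simps)
  also have "\<dots> \<le> ?E v - c * ((1 - \<rho> ^ (2 * n)) * (?E v / S))"
    using upper S0 c q by (intro diff_left_mono mult_left_mono) (auto simp: divide_le_eq mult.commute)
  also have "\<dots> = (1 + - \<kappa>) * ?E v" using S0 by (simp add: \<kappa>_def field_simps)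
  also have "\<dots> \<le> exp (- \<kappa>) * ?E v" by (intro mult_right_mono exp_ge_add_one_self E0 v0)
  also have "\<dots> \<le> exp (- \<kappa>) * (exp (- (real j * \<kappa>)) * ?E w)"
    using Suc.IH by (intro mult_left_mono) (auto simp: v_def \<kappa>_def c_def)
  also have "\<dots> = exp (- (real (Suc j) * \<kappa>)) * ?E w" by (simp add: exp_add[symmetric] algebra_simps)
  finally show ?case by (simp add: v_def \<kappa>_def c_def)
qed simp

text \<open>The step parameter is the \<open>N\<close>-th root of \<sigma>. The discrete rate is not
  sharp for fixed \<open>N\<close>, but \<open>real N * (1 - exp (- (b / real N)))\<close> tends to
  \<open>b\<close>.\<close>

lemma OU_entropy_decay:
  fixes w :: "real ^ 'd \<Rightarrow> real"
  assumes p: "1 \<le> p" "p \<le> 2" and \<sigma>: "0 < \<sigma>" "\<sigma> < 1"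
    and w: "bounded_meas gauss_measure w" "(\<integral>x. w x \<partial>gauss_measure) = 1"
    and m: "0 \<le> m" "\<And>x. m \<le> w x" and B: "\<And>x. w x \<le> B"
    and S: "p / 2 \<le> S" "phi p m \<le> S * (m - 1)\<^sup>2"
    and orth: "hermite_orthogonal n (\<lambda>x. w x - 1)"
  shows "(\<integral>x. phi p (OU \<sigma> w x) \<partial>gauss_measure)
    \<le> \<sigma> powr (real n * p * B powr (p - 2) / S) * (\<integral>x. phi p (w x) \<partial>gauss_measure)"
proof -
  define \<kappa> where "\<kappa> = p * B powr (p - 2) / (2 * S)"
  define b where "b = - (2 * real n * ln \<sigma>)"
  let ?E = "\<lambda>f. \<integral>x. phi p (f x) \<partial>gauss_measure"
  have le: "?E (OU \<sigma> w) \<le> exp (- (\<kappa> * (real N * (1 - exp (- (b / real N)))))) * ?E w" if N: "1 \<le> N" for N :: nat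
  proof -
    define \<rho> where "\<rho> = \<sigma> powr (1 / real N)"
    have \<rho>: "0 < \<rho>" "\<rho> < 1" using \<sigma> N powr_less_mono2[of "1 / real N" \<sigma> 1] by (auto simp: \<rho>_def)
    have \<rho>N: "\<rho> ^ N = \<sigma>" using \<sigma> N by (simp add: \<rho>_def powr_realpow[symmetric] powr_powr)
    have \<rho>n: "\<rho> ^ (2 * n) = exp (- (b / real N))"
      using \<sigma> by (simp add: \<rho>_def powr_realpow[symmetric] powr_powr) (simp add: powr_def b_def)
    obtain i where i: "N = Suc i" using N by (cases N) auto
    have "(OU \<rho> ^^ N) w = OU \<sigma> w" using OU_funpow[OF \<rho> w(1), of i] \<rho>N by (simp add: i)
    then show ?thesis
      using OU_entropy_decay_discrete[OF p \<rho> w m B S orth, of N] unfolding \<rho>n by (simp add: \<kappa>_def mult_ac)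
  qed
  have "(\<lambda>N :: nat. real N * (1 - exp (- (b / real N)))) \<longlonglongrightarrow> b" by real_asymp
  then have "(\<lambda>N. exp (- (\<kappa> * (real N * (1 - exp (- (b / real N)))))) * ?E w) \<longlonglongrightarrow> exp (- (\<kappa> * b)) * ?E w"
    by (intro tendsto_intros)
  then have "?E (OU \<sigma> w) \<le> exp (- (\<kappa> * b)) * ?E w"
    by (rule LIMSEQ_le_const) (use le in blast)
  also have "exp (- (\<kappa> * b)) = \<sigma> powr (real n * p * B powr (p - 2) / S)"
    using \<sigma> by (simp add: powr_def \<kappa>_def b_def mult_ac)
  finally show ?thesis .
qed

section \<open>Entropies, norms and self-similar variables\<close>

lemma entropy_p_eq_phi:
  assumes "1 \<le> p" "p \<le> 2" "bounded_meas gauss_measure w" "\<And>x. 0 \<le> w x" "(\<integral>x. w x \<partial>gauss_measure) = 1"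
  shows "entropy_p p w = (\<integral>x. phi p (w x) \<partial>gauss_measure)"
proof -
  have i: "integrable gauss_measure (\<lambda>x. phi p (w x))" "integrable gauss_measure w"
    using assms by (auto intro!: gauss.bounded_meas_integrable bounded_meas_phi)
  define c where "c = (if p = 1 then 1 else p / (p - 1))"
  have "entropy_p p w = (\<integral>x. phi p (w x) + c * (w x - 1) \<partial>gauss_measure)"
    by (auto simp: entropy_p_def phi_def c_def diff_divide_distrib)
  also have "\<dots> = (\<integral>x. phi p (w x) \<partial>gauss_measure)"
    using i assms by (simp add: gauss.prob_space[simplified])
  finally show ?thesis .
qed

lemma entropy_p_cong_AE:
  assumes [measurable]: "f \<in> borel_measurable borel" "g \<in> borel_measurable borel"
    and eq: "AE x in lborel. f x = g x"
  shows "entropy_p p f = entropy_p p g"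
  unfolding entropy_p_def using eq
  by (auto intro!: integral_cong_AE simp: AE_gauss elim!: eventually_mono)

text \<open>The factor \<open>q\<close> is extracted from the square root only; the other factor is
  merely monotone, its exponent \<open>1 - p / 2\<close> being nonnegative.\<close>

lemma A_fun_le:
  assumes p: "1 \<le> p" and s: "0 \<le> s" "0 \<le> q" "q \<le> 1" "s' \<le> q * s" "p \<le> 2" "0 \<le> s'"
  shows "A_fun p s' \<le> A_fun p s * sqrt q"
proof -
  have "s' \<le> s" using mult_right_mono[of q 1 s] s by simp
  then have "(1 + (p - 1) * s') powr (1 - p / 2) \<le> (1 + (p - 1) * s) powr (1 - p / 2)"
    using p s by (intro powr_mono2) (auto intro!: mult_left_mono add_nonneg_nonneg)
  moreover have "sqrt s' \<le> sqrt s * sqrt q"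
    using s by (simp add: real_sqrt_mult[symmetric] mult.commute)
  ultimately have "2 powr (1 / p) / sqrt p * (1 + (p - 1) * s') powr (1 - p / 2) * sqrt s' \<le>
      2 powr (1 / p) / sqrt p * (1 + (p - 1) * s) powr (1 - p / 2) * (sqrt s * sqrt q)"
    using p s by (intro mult_mono mult_left_mono) auto
  then show ?thesis by (simp add: A_fun_def mult.assoc)
qed

text \<open>Substitute \<open>x = R *\<^sub>R z\<close> and split \<open>v_infty z powr p\<close>
  into \<open>v_infty z\<close> times a power bounded by the maximum of \<open>v_infty\<close>. The
  maximum yields the power of \<open>2 * pi\<close>, the Jacobian and the prefactor the power of
  \<open>R\<close>.\<close>

lemma Lp_norm_rescaled_le:
  fixes f F :: "real ^ 'd \<Rightarrow> real"
  assumes p: "1 \<le> p" and R: "0 < R" and f [measurable]: "f \<in> borel_measurable borel"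
    and int: "integrable gauss_measure (\<lambda>z. \<bar>f z - 1\<bar> powr p)"
    and F: "AE x in lborel. F x = R powr (- real CARD('d)) * v_infty (x /\<^sub>R R) * (f (x /\<^sub>R R) - 1)"
  shows "Lp_norm p F \<le> ennreal ((2 * pi) powr (- (real CARD('d) / 2) * (1 - 1 / p)) *
    R powr (- real CARD('d) * (1 - 1 / p)) * (\<integral>z. \<bar>f z - 1\<bar> powr p \<partial>gauss_measure) powr (1 / p))"
proof -
  let ?d = "real CARD('d)"
  define J where "J = (\<integral>z. \<bar>f z - 1\<bar> powr p \<partial>gauss_measure)"
  define c where "c = (2 * pi) powr (- (?d / 2) * (p - 1)) * R powr (- ?d * (p - 1))"
  have J: "0 \<le> J" by (simp add: J_def)
  have c: "0 \<le> c" by (simp add: c_def)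
  define G where "G x = R powr (- ?d) * v_infty (x /\<^sub>R R) * (f (x /\<^sub>R R) - 1)" for x :: "real ^ 'd"
  have [measurable]: "G \<in> borel_measurable borel" unfolding G_def by measurable
  have GR: "\<bar>G (R *\<^sub>R z)\<bar> powr p * R ^ CARD('d) \<le> c * (v_infty z * \<bar>f z - 1\<bar> powr p)" for z
  proof -
    have v_le: "v_infty z \<le> (2 * pi) powr (- ?d / 2)"
      by (simp add: v_infty_def mult_left_le)
    have "v_infty z powr p = v_infty z * v_infty z powr (p - 1)"
      using v_infty_pos[of z] by (simp add: powr_mult_base)
    also have "\<dots> \<le> v_infty z * ((2 * pi) powr (- ?d / 2)) powr (p - 1)"
      using p v_le by (intro mult_left_mono powr_mono2) auto
    finally have vp: "v_infty z powr p \<le> v_infty z * (2 * pi) powr (- (?d / 2) * (p - 1))"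
      by (simp add: powr_powr)
    have "\<bar>G (R *\<^sub>R z)\<bar> powr p * R ^ CARD('d) =
        (R powr (- ?d * p) * R powr ?d) * (v_infty z powr p * \<bar>f z - 1\<bar> powr p)"
      using R by (simp add: G_def abs_mult powr_mult powr_powr powr_realpow mult_ac)
    also have "R powr (- ?d * p) * R powr ?d = R powr (- ?d * (p - 1))"
      by (simp add: powr_add[symmetric] algebra_simps)
    also have "R powr (- ?d * (p - 1)) * (v_infty z powr p * \<bar>f z - 1\<bar> powr p) \<le>
        R powr (- ?d * (p - 1)) * ((v_infty z * (2 * pi) powr (- (?d / 2) * (p - 1))) * \<bar>f z - 1\<bar> powr p)"
      by (intro mult_left_mono mult_right_mono vp) auto
    finally show ?thesis by (simp add: c_def mult_ac)
  qed
  have "(\<integral>\<^sup>+x. ennreal (\<bar>F x\<bar> powr p) \<partial>lborel) = (\<integral>\<^sup>+x. ennreal (\<bar>G x\<bar> powr p) \<partial>lborel)"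
    using F by (intro nn_integral_cong_AE) (auto simp: G_def)
  also have "\<dots> = (\<integral>\<^sup>+z. ennreal (\<bar>G (R *\<^sub>R z)\<bar> powr p * R ^ CARD('d)) \<partial>lborel)"
    using R by (subst lborel_affine[of R 0])
      (simp_all add: nn_integral_density nn_integral_distr ennreal_mult' ennreal_power mult.commute)
  also have "\<dots> \<le> (\<integral>\<^sup>+z. ennreal (c * (v_infty z * \<bar>f z - 1\<bar> powr p)) \<partial>lborel)"
    by (intro nn_integral_mono ennreal_leI GR)
  also have "\<dots> = ennreal (c * J)"
  proof -
    have "has_bochner_integral gauss_measure (\<lambda>z. \<bar>f z - 1\<bar> powr p) J"
      using int by (simp add: J_def has_bochner_integral_iff)
    then have "has_bochner_integral lborel (\<lambda>z. v_infty z * \<bar>f z - 1\<bar> powr p) J"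
      by (subst (asm) has_bochner_integral_gauss) simp_all
    then have "has_bochner_integral lborel (\<lambda>z. c * (v_infty z * \<bar>f z - 1\<bar> powr p)) (c * J)"
      by (rule has_bochner_integral_mult_right)
    then show ?thesis using c
      by (subst nn_integral_eq_integral) (auto simp: has_bochner_integral_iff intro!: AE_I2 mult_nonneg_nonneg)
  qed
  finally have le: "(\<integral>\<^sup>+x. ennreal (\<bar>F x\<bar> powr p) \<partial>lborel) \<le> ennreal (c * J)" .
  then have fin: "(\<integral>\<^sup>+x. ennreal (\<bar>F x\<bar> powr p) \<partial>lborel) \<noteq> \<infinity>"
    by (auto simp: top_unique)
  have "enn2real (\<integral>\<^sup>+x. ennreal (\<bar>F x\<bar> powr p) \<partial>lborel) \<le> c * J"
    using enn2real_mono[OF le] c J by simp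
  then have "enn2real (\<integral>\<^sup>+x. ennreal (\<bar>F x\<bar> powr p) \<partial>lborel) powr (1 / p) \<le> (c * J) powr (1 / p)"
    using p by (intro powr_mono2) auto
  also have "\<dots> = c powr (1 / p) * J powr (1 / p)" using c J by (simp add: powr_mult)
  also have "c powr (1 / p) = (2 * pi) powr (- (?d / 2) * (1 - 1 / p)) * R powr (- ?d * (1 - 1 / p))"
  proof -
    have e: "(p - 1) * (1 / p) = 1 - 1 / p" using p by (simp add: field_simps)
    show ?thesis
      using R unfolding c_def by (simp only: powr_mult powr_powr mult.assoc e)
  qed
  finally show ?thesis
    using fin by (auto simp: Lp_norm_def Let_def J_def intro: ennreal_leI)
qed

lemma u_infty_rescaled:
  assumes t: "0 \<le> t"
  shows "u_infty t x = sqrt (1 + 2 * t) powr (- real CARD('d)) * v_infty (x /\<^sub>R sqrt (1 + 2 * t) :: real ^ 'd)"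
proof -
  define R where "R = sqrt (1 + 2 * t)"
  have R: "0 < R" "R\<^sup>2 = 1 + 2 * t" using t by (auto simp: R_def)
  have 1: "4 * pi * (t + 1 / 2) = R\<^sup>2 * (2 * pi)" "4 * (t + 1 / 2) = R\<^sup>2 * 2" using R by (simp_all add: algebra_simps)
  have "(R\<^sup>2 * (2 * pi)) powr (- real CARD('d) / 2) = R powr (- real CARD('d)) * (2 * pi) powr (- real CARD('d) / 2)"
  proof -
    have "(R\<^sup>2) powr (- real CARD('d) / 2) = (R powr 2) powr (- real CARD('d) / 2)" using R by simp
    also have "\<dots> = R powr (- real CARD('d))" by (simp only: powr_powr) simp
    finally show ?thesis by (simp add: powr_mult)
  qed
  moreover have "(norm (x /\<^sub>R R))\<^sup>2 = (norm x)\<^sup>2 / R\<^sup>2" using R by (simp add: power_mult_distrib power_inverse divide_inverse)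
  ultimately show ?thesis
    using R unfolding R_def[symmetric] u_infty_def heat_kernel_def v_infty_def 1 by simp
qed

text \<open>The self-similar change of variables turning the heat flow into the Ornstein--Uhlenbeck flow.\<close>

lemma heat_kernel_mehler:
  fixes z y :: "real ^ 'd"
  assumes t: "0 < t"
  defines "R \<equiv> sqrt (1 + 2 * t)"
  shows "heat_kernel t (R *\<^sub>R z) y = R powr (- real CARD('d)) * v_infty z * mehler (1 / R) z y"
proof -
  have R: "0 < R" "R\<^sup>2 = 1 + 2 * t" using t by (auto simp: R_def)
  have r: "1 - (1 / R)\<^sup>2 = 2 * t / R\<^sup>2" using R t by (simp add: power_divide field_simps)
  let ?d = "- real CARD('d) / 2"
  have "(4 * pi * t) powr ?d = (R\<^sup>2 * (2 * pi) * (2 * t / R\<^sup>2)) powr ?d" using R(1) by (simp add: mult_ac)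
  also have "\<dots> = (R\<^sup>2) powr ?d * (2 * pi) powr ?d * (2 * t / R\<^sup>2) powr ?d"
    by (simp only: powr_mult)
  also have "(R\<^sup>2) powr ?d = R powr (- real CARD('d))"
  proof -
    have "(R\<^sup>2) powr ?d = (R powr 2) powr ?d" using R by simp
    also have "\<dots> = R powr (- real CARD('d))" by (simp only: powr_powr) simp
    finally show ?thesis .
  qed
  finally have 1: "(4 * pi * t) powr ?d = R powr (- real CARD('d)) * (2 * pi) powr ?d * (2 * t / R\<^sup>2) powr ?d" .
  have 2: "- (norm (R *\<^sub>R z - y))\<^sup>2 / (4 * t) = - (norm z)\<^sup>2 / 2 +
      - ((1 / R)\<^sup>2 * (norm z)\<^sup>2 + (1 / R)\<^sup>2 * (norm y)\<^sup>2 - 2 * (1 / R) * (z \<bullet> y)) / (2 * (2 * t / R\<^sup>2))"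
  proof -
    have "(norm (R *\<^sub>R z - y))\<^sup>2 = R\<^sup>2 * (norm z)\<^sup>2 + (norm y)\<^sup>2 - 2 * R * (z \<bullet> y)"
      unfolding power2_norm_eq_inner
      by (simp add: inner_diff_left inner_diff_right inner_commute power2_eq_square algebra_simps)
    moreover have "- (R\<^sup>2 * A + C - 2 * R * c) / (4 * t) = - A / 2 +
        - ((1 / R)\<^sup>2 * A + (1 / R)\<^sup>2 * C - 2 * (1 / R) * c) / (2 * (2 * t / R\<^sup>2))" for A C c :: real
    proof -
      have e1: "((1 / R)\<^sup>2 * A + (1 / R)\<^sup>2 * C - 2 * (1 / R) * c) / (2 * (2 * t / R\<^sup>2)) = (A + C - 2 * R * c) / (4 * t)"
        using R(1) t by (simp add: field_simps power2_eq_square)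
      have e2: "(R\<^sup>2 * A + C - 2 * R * c) / (4 * t) = A / 2 + (A + C - 2 * R * c) / (4 * t)"
        using t unfolding R(2) by (simp add: field_simps)
      show ?thesis unfolding minus_divide_left[symmetric] e1 e2 by simp
    qed
    ultimately show ?thesis by simp
  qed
  show ?thesis
    unfolding heat_kernel_def mehler_def v_infty_def 1 2 r exp_add by (simp only: mult_ac)
qed

text \<open>The relation between \<open>u0\<close> and \<open>w\<close> is required almost
  everywhere only, so that a truncation of \<open>u0 / v_infty\<close> can be inserted for
  \<open>w\<close>.\<close>

lemma heat_solution_rescaled:
  fixes u0 :: "real ^ 'd \<Rightarrow> real"
  assumes t: "0 < t"
  defines "R \<equiv> sqrt (1 + 2 * t)"
  assumes [measurable]: "u0 \<in> borel_measurable borel" "w \<in> borel_measurable borel"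
    and w: "AE x in lborel. u0 x = v_infty x * w x"
  shows "heat_solution u0 t x = R powr (- real CARD('d)) * v_infty (x /\<^sub>R R) * OU (1 / R) w (x /\<^sub>R R)"
proof -
  have R: "0 < R" using t by (auto simp: R_def)
  have [measurable]: "(\<lambda>y. heat_kernel t x y) \<in> borel_measurable borel" "mehler (1 / R) (x /\<^sub>R R) \<in> borel_measurable borel"
    unfolding heat_kernel_def mehler_def by measurable
  let ?c = "R powr (- real CARD('d)) * v_infty (x /\<^sub>R R)"
  have k: "heat_kernel t x y = ?c * mehler (1 / R) (x /\<^sub>R R) y" for y
    using heat_kernel_mehler[OF t, of "x /\<^sub>R R" y] R unfolding R_def[symmetric] by simp
  have "heat_solution u0 t x = (\<integral>y. u0 y * heat_kernel t x y \<partial>lborel)" using t by (simp add: heat_solution_def)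
  also have "\<dots> = (\<integral>y. ?c * (v_infty y * (mehler (1 / R) (x /\<^sub>R R) y * w y)) \<partial>lborel)"
  proof (rule integral_cong_AE)
    show "AE y in lborel. u0 y * heat_kernel t x y = ?c * (v_infty y * (mehler (1 / R) (x /\<^sub>R R) y * w y))"
      using w by eventually_elim (simp add: k mult_ac)
  qed simp_all
  also have "\<dots> = ?c * (\<integral>y. v_infty y * (mehler (1 / R) (x /\<^sub>R R) y * w y) \<partial>lborel)" by simp
  also have "(\<integral>y. v_infty y * (mehler (1 / R) (x /\<^sub>R R) y * w y) \<partial>lborel) = OU (1 / R) w (x /\<^sub>R R)"
    unfolding kernel_op_def by (rule integral_gauss[symmetric]) measurable
  finally show ?thesis .
qed

section \<open>Essential suprema and the final estimate\<close>

lemma AE_lborel_ex: "(AE x in (lborel :: (real ^ 'd) measure). P x) \<Longrightarrow> \<exists>x. P x"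
  using eventually_happens'[OF gauss.ae_filter_bot, of P] by (simp add: AE_gauss)

text \<open>The two bounds keep the extended supremum finite, so converting it to a real number does
  not fall back to the default value 0.\<close>

lemma AE_le_real_esssup:
  fixes f :: "real ^ 'd \<Rightarrow> real"
  assumes [measurable]: "f \<in> borel_measurable borel"
    and b: "AE x in lborel. 0 \<le> f x" "AE x in lborel. f x \<le> C"
  shows "AE x in lborel. f x \<le> real_of_ereal (esssup lborel (\<lambda>x. ereal (f x)))"
proof -
  define e where "e = esssup lborel (\<lambda>x. ereal (f x))"
  have e: "AE x in lborel. ereal (f x) \<le> e" unfolding e_def by (rule esssup_AE)
  have "e \<le> ereal C" unfolding e_def using b(2) by (intro esssup_I) auto
  moreover obtain x where "0 \<le> f x" "ereal (f x) \<le> e"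
    using AE_lborel_ex[OF AE_conjI[OF b(1) e]] by blast
  then have "0 \<le> e" by (intro order_trans[of 0 "ereal (f x)" e]) simp_all
  ultimately obtain r where "e = ereal r" by (cases e) auto
  then show ?thesis using e by (simp add: e_def[symmetric])
qed

lemma closed_phi_le: "1 \<le> p \<Longrightarrow> closed {s. 0 \<le> s \<and> phi p s \<le> S * (s - 1)\<^sup>2}"
  using continuous_on_closed_Collect_le[of "{0..}" "phi p" "\<lambda>s. S * (s - 1)\<^sup>2"]
  by (simp add: continuous_on_phi continuous_intros)

text \<open>Take for \<open>m\<close> the infimum of the set \<open>Z\<close> of values satisfying
  the quadratic bound. Almost all values of \<open>w0\<close> lie in \<open>Z\<close>, and
  \<open>Z\<close> is closed, so \<open>m\<close> is a lower bound that itself satisfies the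
  estimate.\<close>

lemma phi_le_esssup_bound:
  fixes w0 :: "real ^ 'd \<Rightarrow> real"
  assumes p: "1 \<le> p" "p \<le> 2" and [measurable]: "w0 \<in> borel_measurable borel"
    and M: "AE x in lborel. 0 \<le> w0 x \<and> w0 x \<le> M" and S: "AE x in lborel. h_fun p (w0 x) \<le> S"
    and int: "(\<integral>x. w0 x \<partial>gauss_measure) = 1"
  obtains m where "0 \<le> m" "m \<le> M" "AE x in lborel. m \<le> w0 x" "phi p m \<le> S * (m - 1)\<^sup>2" "p / 2 \<le> S" "1 \<le> M"
proof -
  define Z where "Z = {s. 0 \<le> s \<and> phi p s \<le> S * (s - 1)\<^sup>2}"
  have Zw: "AE x in lborel. w0 x \<in> Z"
    using M S by eventually_elim (auto simp: Z_def phi_le_h_fun p)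
  have bdd: "bdd_below Z" by (auto simp: Z_def intro: bdd_belowI[of _ 0])
  obtain x where x: "w0 x \<in> Z" "w0 x \<le> M" using AE_lborel_ex[OF AE_conjI[OF Zw M]] by auto
  have "Inf Z \<in> Z"
    using x bdd closed_phi_le[OF p(1), of S] by (intro closed_contains_Inf) (auto simp: Z_def)
  have "AE x in lborel. norm (w0 x) \<le> M" using M by eventually_elim auto
  then have i0: "integrable gauss_measure w0"
    by (intro gauss.integrable_const_bound[of _ M]) (simp_all add: AE_gauss)
  have "(\<integral>x. w0 x \<partial>gauss_measure) \<le> (\<integral>x. M \<partial>(gauss_measure :: (real ^ 'd) measure))"
    using M i0 by (intro integral_mono_AE) (simp_all add: AE_gauss)
  then have M1: "1 \<le> M" using int by (simp add: gauss.prob_space[simplified])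
  have "p / 2 \<le> S"
  \<comment> \<open>On \<open>[0, 1]\<close> the function \<open>h_fun p\<close> is at least
    \<open>p / 2\<close>, so a smaller \<open>S\<close> would force \<open>w0 > 1\<close> almost
    everywhere, against its mean being one.\<close>
  proof (rule ccontr)
    assume neg: "\<not> p / 2 \<le> S"
    have gt: "AE x in lborel. 1 < w0 x"
      using M S by eventually_elim (use neg h_fun_ge_half[OF p] in \<open>force simp: not_le\<close>)
    have "(\<integral>x. w0 x - 1 \<partial>gauss_measure) = 0" using i0 int by (simp add: gauss.prob_space[simplified])
    moreover have "AE x in gauss_measure. 0 \<le> w0 x - 1"
      using gt by (auto simp: AE_gauss elim!: eventually_mono)
    ultimately have "AE x in gauss_measure. w0 x - 1 = 0"
      using i0 by (subst (asm) integral_nonneg_eq_0_iff_AE) auto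
    then have "AE x in lborel. w0 x = 1" by (simp add: AE_gauss)
    with gt have "\<exists>x. 1 < w0 x \<and> w0 x = 1" by (intro AE_lborel_ex) auto
    then show False by auto
  qed
  moreover have "Inf Z \<le> M" using x bdd by (meson cInf_lower order_trans)
  moreover have "AE x in lborel. Inf Z \<le> w0 x"
    using Zw by eventually_elim (use bdd in \<open>auto intro: cInf_lower\<close>)
  ultimately show ?thesis using that \<open>Inf Z \<in> Z\<close> M1 by (auto simp: Z_def)
qed

theorem corollary4:
  fixes n :: nat and p :: real and u0 w0 :: "real ^ 'd \<Rightarrow> real" and t :: real
  assumes "1 \<le> n"
    and "1 \<le> p" and "p \<le> 2"
    and "u0 \<in> borel_measurable lborel"
    and "AE x in lborel. 0 \<le> u0 x"
    and "(\<integral>\<^sup>+x. ennreal (u0 x) \<partial>lborel) = 1"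
    and "w0 = (\<lambda>x. u0 x / v_infty x)"
    and "\<exists>C. AE x in lborel. \<bar>w0 x\<bar> \<le> C"
    and "\<And>k :: 'd \<Rightarrow> nat. 0 < (\<Sum>j\<in>UNIV. k j) \<Longrightarrow> (\<Sum>j\<in>UNIV. k j) < n \<Longrightarrow>
           (\<integral>x. u0 x * multi_hermite k x \<partial>lborel) = 0"
    and "0 \<le> t"
  shows "Lp_norm p (\<lambda>x. heat_solution u0 t x - u_infty t x)
    \<le> ennreal ((2 * pi) powr (- (real CARD('d) / 2) * (1 - 1 / p)) * A_fun p (entropy_p p w0)
        * (1 + 2 * t) powr (- (real n * p / (4 * H_functional p w0))
                            - real CARD('d) / 2 * (1 - 1 / p)))"
proof -
  note p = assms(2,3)
  define M where "M = Linfty_norm w0"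
  define S where "S = real_of_ereal (esssup lborel (\<lambda>x. ereal (h_fun p (w0 x))))"
  have u0 [measurable]: "u0 \<in> borel_measurable borel" using assms(4) by simp
  have w0 [measurable]: "w0 \<in> borel_measurable borel" unfolding assms(7) by measurable
  have u0w0: "u0 x = v_infty x * w0 x" for x using v_infty_pos[of x] by (simp add: assms(7))
  have pos: "AE x in lborel. 0 \<le> w0 x"
    using assms(5) by eventually_elim (simp add: assms(7))
  have "AE x in lborel. \<bar>w0 x\<bar> \<le> M"
  proof -
    obtain C where "AE x in lborel. \<bar>w0 x\<bar> \<le> C" using assms(8) by blast
    then show ?thesis unfolding M_def Linfty_norm_def by (intro AE_le_real_esssup) auto
  qed
  with pos have M: "AE x in lborel. 0 \<le> w0 x \<and> w0 x \<le> M" by eventually_elim auto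
  have S: "AE x in lborel. h_fun p (w0 x) \<le> S"
    unfolding S_def
  proof (rule AE_le_real_esssup)
    show "AE x in lborel. 0 \<le> h_fun p (w0 x)"
      using pos by eventually_elim (simp add: h_fun_nonneg p)
    show "AE x in lborel. h_fun p (w0 x) \<le> 1"
      using pos by eventually_elim (simp add: h_fun_le_1 p)
  qed measurable
  have "has_bochner_integral lborel u0 1"
    using assms(5,6) by (intro has_bochner_integral_nn_integral) auto
  then have "has_bochner_integral lborel (\<lambda>x. v_infty x * w0 x) 1" by (simp add: u0w0[symmetric])
  then have int0: "(\<integral>x. w0 x \<partial>gauss_measure) = 1"
    by (simp add: integral_gauss has_bochner_integral_iff)
  obtain m where m: "0 \<le> m" "m \<le> M" "AE x in lborel. m \<le> w0 x" "phi p m \<le> S * (m - 1)\<^sup>2"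
    and S2: "p / 2 \<le> S" and M1: "1 \<le> M"
    using phi_le_esssup_bound[OF p w0 M S int0] by blast
  \<comment> \<open>Clamping changes \<open>w0\<close> on a null set only and makes the bounds hold
    everywhere.\<close>
  define w where "w x = min M (max m (w0 x))" for x
  have wm [measurable]: "w \<in> borel_measurable borel" unfolding w_def by measurable
  have ww0: "AE x in lborel. w x = w0 x" using M m(3) by eventually_elim (simp add: w_def)
  have w_b: "m \<le> w x" "w x \<le> M" for x using m(2) by (auto simp: w_def)
  have w_nn: "0 \<le> w x" for x using w_b(1)[of x] m(1) by simp
  have bw: "bounded_meas gauss_measure w"
    by (rule bounded_measI[of _ _ M]) (use w_b w_nn in auto)
  have cong: "(\<integral>x. f x (w x) \<partial>gauss_measure) = (\<integral>x. f x (w0 x) \<partial>gauss_measure)"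
    if "case_prod f \<in> borel_measurable (borel \<Otimes>\<^sub>M borel)" for f :: "real ^ 'd \<Rightarrow> real \<Rightarrow> real"
    using that ww0 by (intro integral_cong_AE) (auto simp: AE_gauss elim!: eventually_mono)
  have int: "(\<integral>x. w x \<partial>gauss_measure) = 1" using cong[of "\<lambda>x y. y"] int0 by simp
  have orth: "hermite_orthogonal n (\<lambda>x. w x - 1)"
    unfolding hermite_orthogonal_def
  proof (intro allI impI)
    fix k :: "'d \<Rightarrow> nat" assume k: "(\<Sum>j\<in>UNIV. k j) < n"
    have "(\<integral>x. (w x - 1) * multi_hermite k x \<partial>gauss_measure) =
        (\<integral>x. w x * multi_hermite k x \<partial>gauss_measure) - (\<integral>x. multi_hermite k x \<partial>gauss_measure)"
      by (simp add: left_diff_distrib integrable_mult_multi_hermite bw integrable_multi_hermite)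
    also have "\<dots> = 0"
    proof (cases "(\<Sum>j\<in>UNIV. k j) = 0")
      case True
      then have "k = (\<lambda>_. 0)" by (auto simp: fun_eq_iff)
      then show ?thesis using int by (simp add: gauss.prob_space[simplified])
    next
      case False
      have "(\<integral>x. w x * multi_hermite k x \<partial>gauss_measure) = (\<integral>x. w0 x * multi_hermite k x \<partial>gauss_measure)"
        by (rule cong[of "\<lambda>x y. y * multi_hermite k x"]) measurable
      also have "\<dots> = (\<integral>x. u0 x * multi_hermite k x \<partial>lborel)"
        by (simp add: integral_gauss u0w0 mult.assoc)
      finally show ?thesis using assms(9)[of k] integral_multi_hermite[of k] k False by simp
    qed
    finally show "(\<integral>x. (w x - 1) * multi_hermite k x \<partial>gauss_measure) = 0" .
  qed
  define E where "E = (\<integral>x. phi p (w x) \<partial>gauss_measure)"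
  have E: "entropy_p p w0 = E"
    using entropy_p_cong_AE[OF wm w0 ww0] entropy_p_eq_phi[OF p bw w_nn int] by (simp add: E_def)
  have E0: "0 \<le> E" by (simp add: E_def phi_nonneg p w_nn)
  define R where "R = sqrt (1 + 2 * t)"
  have R: "0 < R" "1 \<le> R" using assms(10) by (auto simp: R_def)
  \<comment> \<open>At \<open>t = 0\<close> the kernel parameter \<open>1 / R\<close> is 1 and
    Mehler's kernel degenerates, so the initial density itself is used.\<close>
  define f where "f = (if t = 0 then w else OU (1 / R) w)"
  define q where "q = (1 / R) powr (real n * p * M powr (p - 2) / S)"
  have S0: "0 < S" using S2 p by simp
  have q: "0 \<le> q" "q \<le> 1"
    using R S0 p powr_mono2[of "real n * p * M powr (p - 2) / S" "1 / R" 1] by (auto simp: q_def)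
  have \<rho>: "0 < 1 / R" "1 / R < 1" if "t \<noteq> 0" using that assms(10) by (auto simp: R_def)
  note markov = symmetric_markov_mehler[OF \<rho>]
  have f: "bounded_meas gauss_measure f" "\<And>x. 0 \<le> f x" "(\<integral>x. f x \<partial>gauss_measure) = 1"
    unfolding f_def
    using bw w_nn int symmetric_markov.bounded_meas_op[OF markov bw]
      symmetric_markov.op_lower[OF markov bw w_nn] symmetric_markov.integral_op[OF markov bw]
    by simp_all
  have f_entropy: "(\<integral>x. phi p (f x) \<partial>gauss_measure) \<le> q * E"
    using OU_entropy_decay[OF p \<rho> bw int m(1) w_b(1) w_b(2) S2 m(4) orth]
    by (cases "t = 0") (simp_all add: f_def q_def E_def R_def)
  have f_heat: "AE x in lborel. heat_solution u0 t x - u_infty t x =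
      R powr (- real CARD('d)) * v_infty (x /\<^sub>R R) * (f (x /\<^sub>R R) - 1)"
    using ww0
  proof eventually_elim
    case (elim x)
    have "AE x in lborel. u0 x = v_infty x * w x" using ww0 by eventually_elim (simp add: u0w0)
    then have "heat_solution u0 t x = R powr (- real CARD('d)) * v_infty (x /\<^sub>R R) * f (x /\<^sub>R R)"
      using heat_solution_rescaled[of t u0 w x] assms(10) elim
      by (cases "t = 0") (simp_all add: f_def R_def heat_solution_def u0w0)
    moreover have "u_infty t x = R powr (- real CARD('d)) * v_infty (x /\<^sub>R R)"
      using u_infty_rescaled[OF assms(10), of x] by (simp add: R_def)
    ultimately show ?case by (simp add: right_diff_distrib)
  qed
  define J where "J = (\<integral>z. \<bar>f z - 1\<bar> powr p \<partial>gauss_measure)"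
  have fm [measurable]: "f \<in> borel_measurable borel" using f(1) by (auto dest: bounded_meas_measurable)
  have "bounded_meas gauss_measure (\<lambda>z. \<bar>f z - 1\<bar> powr p)"
  proof -
    obtain B where B: "\<And>x. \<bar>f x\<bar> \<le> B" using f(1) by (metis bounded_measE)
    have "\<bar>f x - 1\<bar> \<le> B + 1" for x using B[of x] by linarith
    then have "\<bar>\<bar>f x - 1\<bar> powr p\<bar> \<le> (B + 1) powr p" for x using p by (auto intro!: powr_mono2)
    then show ?thesis by (intro bounded_measI) auto
  qed
  from Lp_norm_rescaled_le[OF p(1) R(1) fm gauss.bounded_meas_integrable[OF this] f_heat]
  have "Lp_norm p (\<lambda>x. heat_solution u0 t x - u_infty t x) \<le>
      ennreal ((2 * pi) powr (- (real CARD('d) / 2) * (1 - 1 / p)) * R powr (- real CARD('d) * (1 - 1 / p)) * J powr (1 / p))"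
    by (simp add: J_def)
  also have "\<dots> \<le> ennreal ((2 * pi) powr (- (real CARD('d) / 2) * (1 - 1 / p)) *
      R powr (- real CARD('d) * (1 - 1 / p)) * (A_fun p E * sqrt q))"
  proof (intro ennreal_leI mult_left_mono)
    have "J powr (1 / p) \<le> A_fun p (\<integral>x. phi p (f x) \<partial>gauss_measure)"
      unfolding J_def by (rule gauss.Lp_distance_le_A_fun[OF p f])
    also have "\<dots> \<le> A_fun p E * sqrt q"
      by (rule A_fun_le[OF p(1) E0 q f_entropy p(2)]) (simp add: phi_nonneg p f(2))
    finally show "J powr (1 / p) \<le> A_fun p E * sqrt q" .
  qed auto
  finally have le: "Lp_norm p (\<lambda>x. heat_solution u0 t x - u_infty t x) \<le>
      ennreal ((2 * pi) powr (- (real CARD('d) / 2) * (1 - 1 / p)) *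
        R powr (- real CARD('d) * (1 - 1 / p)) * (A_fun p E * sqrt q))" .
  have rate: "R powr (- real CARD('d) * (1 - 1 / p)) * (A_fun p E * sqrt q) =
      A_fun p E * (1 + 2 * t) powr (- (real n * p / (4 * H_functional p w0)) - real CARD('d) / 2 * (1 - 1 / p))"
  proof -
    have Rp: "R = (1 + 2 * t) powr (1 / 2)" using assms(10) by (simp add: R_def powr_half_sqrt)
    have H: "H_functional p w0 = M powr (2 - p) * S" by (simp add: H_functional_def M_def S_def)
    have Mp: "M powr (p - 2) = 1 / M powr (2 - p)" using M1 by (simp add: powr_minus_divide[symmetric])
    have "sqrt q = R powr (- (real n * p * M powr (p - 2) / S) / 2)"
      using R by (simp add: q_def powr_half_sqrt[symmetric] powr_powr powr_divide powr_minus_divide)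
    also have "\<dots> = (1 + 2 * t) powr (- (real n * p / (4 * H_functional p w0)))"
      unfolding Rp powr_powr H Mp by (rule arg_cong[where f = "\<lambda>a. (1 + 2 * t) powr a"]) (simp add: mult_ac)
    finally have sq: "sqrt q = (1 + 2 * t) powr (- (real n * p / (4 * H_functional p w0)))" .
    have rd: "R powr (- real CARD('d) * (1 - 1 / p)) = (1 + 2 * t) powr (- (real CARD('d) / 2 * (1 - 1 / p)))"
      unfolding Rp powr_powr by (rule arg_cong[where f = "\<lambda>a. (1 + 2 * t) powr a"]) simp
    show ?thesis unfolding sq rd diff_conv_add_uminus[of "- (real n * p / (4 * H_functional p w0))"] powr_add
      by (simp only: mult_ac)
  qed
  show ?thesis using le unfolding E by (simp only: mult.assoc rate)
qed

end
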